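(* Let $n\ge 2$, $Q=2n+2$, and $1\le p,\bar p_1,\bar p_2\le\infty$. Let $H$ be the Hardy–Littlewood–Pólya operator on the Heisenberg group $\mathbb{H}^n$, $$Hf(x)=\int_{\mathbb{H}^n}\frac{f(y)}{\max(|x|_h^Q,|y|_h^Q)}\,dy,\qquad x\in\mathbb{H}^n\setminus\{0\}.$$ Then $H$ is bounded from $L^p_{|x|_h}L^{\bar p_1}_\theta(\mathbb{H}^n)$ to $L^p_{|x|_h}L^{\bar p_2}_\theta(\mathbb{H}^n)$, with $$\|H\|_{L^p_{|x|_h}L^{\bar p_1}_\theta(\mathbb{H}^n)\to L^p_{|x|_h}L^{\bar p_2}_\theta(\mathbb{H}^n)}\le G,$$ where the sharp constant is $$G=\omega_Q^{1/\bar p_2-1/\bar p_1}\int_{\mathbb{H}^n}\frac{|y|_h^{-Q/p}}{\max(1,|y|_h^Q)}\,dy .$$ In addition, if $H$ is bounded, then its norm is $$\|H\|_{L^p_{|x|_h}L^{\bar p_1}_\theta(\mathbb{H}^n)\to L^p_{|x|_h}L^{\bar p_2}_\theta(\mathbb{H}^n)}=G.$$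
   Context: The Heisenberg group $\mathbb{H}^n$ is $\mathbb{R}^{2n+1}$ with group law $x\circ y=\big(x_1+y_1,\ldots,x_{2n}+y_{2n},\,x_{2n+1}+y_{2n+1}+2\sum_{j=1}^n(y_jx_{n+j}-x_jy_{n+j})\big)$. Its Haar measure $dx$ is Lebesgue measure on $\mathbb{R}^{2n+1}$. The dilations are $\delta_r(x_1,\ldots,x_{2n},x_{2n+1})=(rx_1,\ldots,rx_{2n},r^2x_{2n+1})$ for $r>0$, and $|\delta_r(E)|=r^Q|E|$, where $Q=2n+2$ is the homogeneous dimension. The homogeneous norm is $|x|_h=\big[\big(\sum_{i=1}^{2n}x_i^2\big)^2+x_{2n+1}^2\big]^{1/4}$. Let $\mathbb{S}^{Q-1}=\{x\in\mathbb{H}^n:|x|_h=1\}$ be the unit sphere, with the measure $d\theta$ for which the polar coordinate formula $\int_{\mathbb{H}^n}f(x)\,dx=\int_0^\infty\int_{\mathbb{S}^{Q-1}}f(\delta_r\theta)\,r^{Q-1}\,d\theta\,dr$ holds. Its total mass is $\omega_Q=\int_{\mathbb{S}^{Q-1}}d\theta=Q\,|\{x\in\mathbb{H}^n:|x|_h<1\}|$. For $1\le p,\bar p\le\infty$, the mixed radial-angular space $L^p_{|x|_h}L^{\bar p}_\theta(\mathbb{H}^n)$ consists of all functions $f$ on $\mathbb{H}^n$ with $$\|f\|_{L^p_{|x|_h}L^{\bar p}_\theta(\mathbb{H}^n)}=\left(\int_0^\infty\left(\int_{\mathbb{S}^{Q-1}}|f(\delta_r\theta)|^{\bar p}\,d\theta\right)^{p/\bar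 p}r^{Q-1}\,dr\right)^{1/p}<\infty,$$ with the usual essential-supremum modification when $p=\infty$ or $\bar p=\infty$ (and $1/\infty=0$). The operator norm $\|H\|$ is the supremum of $\|Hf\|/\|f\|$ over nonzero $f$ in the domain space.
   Formalization: Boundedness of H is asserted only for 1 < p < ∞, since it fails at p = 1 (indicator of the unit ball) and p = ∞ (f = 1), where G = ∞; the inequality ‖H‖ ≤ G and the conditional equality are kept for all 1 ≤ p ≤ ∞ with values in [0,∞]. *)

theory Defs
  imports "HOL-Analysis.Analysis" "HOL-Probability.Essential_Supremum"
begin

(* A point (x_1, ..., x_2n, x_2n+1) is stored as (a, b, t) with a = (x_1, ..., x_n),
   b = (x_n+1, ..., x_2n) and t = x_2n+1, where n = CARD('n).  Lebesgue measure on this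
   Euclidean space is lborel; see lborel_left_invariant_heis_mult. *)
type_synonym 'n heis = "(real ^ 'n) \<times> (real ^ 'n) \<times> real"

definition heis_mult :: "'n::finite heis \<Rightarrow> 'n heis \<Rightarrow> 'n heis" where
  "heis_mult = (\<lambda>(a, b, t) (a', b', t').
     (a + a', b + b', t + t' + 2 * (\<Sum>j\<in>UNIV. a' $ j * b $ j - a $ j * b' $ j)))"

definition heis_dilate :: "real \<Rightarrow> 'n::finite heis \<Rightarrow> 'n heis" where
  "heis_dilate r = (\<lambda>(a, b, t). (r *\<^sub>R a, r *\<^sub>R b, r\<^sup>2 * t))"

definition heis_norm :: "'n::finite heis \<Rightarrow> real" where
  "heis_norm = (\<lambda>(a, b, t).
     root 4 (((\<Sum>i\<in>UNIV. (a $ i)\<^sup>2) + (\<Sum>i\<in>UNIV. (b $ i)\<^sup>2))\<^sup>2 + t\<^sup>2))"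

definition heis_hdim :: "'n::finite itself \<Rightarrow> nat" where
  "heis_hdim _ = 2 * CARD('n) + 2"

definition heis_sphere :: "'n::finite heis set" where
  "heis_sphere = {x. heis_norm x = 1}"

definition is_heis_polar_measure :: "'n::finite heis measure \<Rightarrow> bool" where
  "is_heis_polar_measure \<sigma> \<longleftrightarrow>
     sets \<sigma> = sets (restrict_space borel heis_sphere) \<and>
     (\<forall>f \<in> borel_measurable borel. (\<integral>\<^sup>+ x. f x \<partial>lborel) =
        (\<integral>\<^sup>+ r\<in>{0<..}. (\<integral>\<^sup>+ \<theta>. f (heis_dilate r \<theta>) \<partial>\<sigma>) * ennreal (r ^ (heis_hdim TYPE('n) - 1)) \<partial>lborel))"

(* Existence and uniqueness: ex1_heis_polar_measure below. *)
definition heis_sphere_measure :: "'n::finite heis measure" where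
  "heis_sphere_measure = (THE \<sigma>. is_heis_polar_measure \<sigma>)"

definition heis_omega :: "'n::finite itself \<Rightarrow> real" where
  "heis_omega _ = measure (heis_sphere_measure :: 'n heis measure) heis_sphere"

(* x to the power a, for a > 0 only *)
definition ennreal_powr :: "ennreal \<Rightarrow> real \<Rightarrow> ennreal" where
  "ennreal_powr x a = (if x = \<infinity> then \<infinity> else ennreal (enn2real x powr a))"

definition lp_enorm :: "ennreal \<Rightarrow> 'a measure \<Rightarrow> ('a \<Rightarrow> ennreal) \<Rightarrow> ennreal" where
  "lp_enorm p M g =
     (if p = \<infinity> then esssup M g
      else ennreal_powr (\<integral>\<^sup>+ x. ennreal_powr (g x) (enn2real p) \<partial>M) (1 / enn2real p))"

definition heis_radial_measure :: "'n::finite itself \<Rightarrow> real measure" where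
  "heis_radial_measure _ =
     density lborel (\<lambda>r. ennreal (r ^ (heis_hdim TYPE('n) - 1)) * indicator {0<..} r)"

definition mixed_enorm :: "ennreal \<Rightarrow> ennreal \<Rightarrow> ('n::finite heis \<Rightarrow> complex) \<Rightarrow> ennreal" where
  "mixed_enorm p q f =
     lp_enorm p (heis_radial_measure TYPE('n))
       (\<lambda>r. lp_enorm q heis_sphere_measure (\<lambda>\<theta>. ennreal (norm (f (heis_dilate r \<theta>)))))"

(* Functions rather than classes modulo null sets; every Lebesgue class has a Borel representative. *)
definition mixed_space :: "ennreal \<Rightarrow> ennreal \<Rightarrow> ('n::finite heis \<Rightarrow> complex) set" where
  "mixed_space p q = {f. f \<in> borel_measurable borel \<and> mixed_enorm p q f < \<infinity>}"

definition mixed_opnorm :: "ennreal \<Rightarrow> ennreal \<Rightarrow> ennreal \<Rightarrow>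
    (('n::finite heis \<Rightarrow> complex) \<Rightarrow> ('n heis \<Rightarrow> complex)) \<Rightarrow> ennreal" where
  "mixed_opnorm p q1 q2 T =
     (SUP f \<in> {f \<in> mixed_space p q1. mixed_enorm p q1 f \<noteq> 0}. mixed_enorm p q2 (T f) / mixed_enorm p q1 f)"

definition hlp_integrand :: "('n::finite heis \<Rightarrow> complex) \<Rightarrow> 'n heis \<Rightarrow> 'n heis \<Rightarrow> complex" where
  "hlp_integrand f x y = f y /
     complex_of_real (max (heis_norm x ^ heis_hdim TYPE('n)) (heis_norm y ^ heis_hdim TYPE('n)))"

definition hlp_op :: "('n::finite heis \<Rightarrow> complex) \<Rightarrow> 'n heis \<Rightarrow> complex" where
  "hlp_op f x = (\<integral> y. hlp_integrand f x y \<partial>lborel)"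

(* The library integral of a non-integrable function is 0, so convergence of the integral
   defining the operator is part of boundedness. *)
definition hlp_bounded :: "'n::finite itself \<Rightarrow> ennreal \<Rightarrow> ennreal \<Rightarrow> ennreal \<Rightarrow> bool" where
  "hlp_bounded _ p q1 q2 \<longleftrightarrow>
     (\<forall>f \<in> mixed_space p q1 :: ('n heis \<Rightarrow> complex) set.
        (\<forall>x. x \<noteq> 0 \<longrightarrow> integrable lborel (hlp_integrand f x)) \<and> hlp_op f \<in> mixed_space p q2) \<and>
     (\<exists>C::real. \<forall>f \<in> mixed_space p q1 :: ('n heis \<Rightarrow> complex) set.
        mixed_enorm p q2 (hlp_op f) \<le> ennreal C * mixed_enorm p q1 f)"

(* 1 / \<infinity> = 0 in ennreal.  The value is \<infinity> when the integral diverges. *)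
definition hlp_const :: "'n::finite itself \<Rightarrow> ennreal \<Rightarrow> ennreal \<Rightarrow> ennreal \<Rightarrow> ennreal" where
  "hlp_const _ p q1 q2 =
     ennreal (heis_omega TYPE('n) powr (enn2real (1 / q2) - enn2real (1 / q1))) *
     (\<integral>\<^sup>+ (y :: 'n heis). ennreal (heis_norm y powr (- real (heis_hdim TYPE('n)) * enn2real (1 / p))
        / max 1 (heis_norm y ^ heis_hdim TYPE('n))) \<partial>lborel)"

lemma nn_integral_lborel_add:
  fixes f :: "'a::euclidean_space \<Rightarrow> ennreal"
  assumes [measurable]: "f \<in> borel_measurable borel"
  shows "(\<integral>\<^sup>+ x. f (c + x) \<partial>lborel) = (\<integral>\<^sup>+ x. f x \<partial>lborel)"
proof -
  have "(\<integral>\<^sup>+ x. f x \<partial>lborel) = (\<integral>\<^sup>+ x. f x \<partial>distr lborel borel ((+) c))"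
    by (simp add: lborel_distr_plus)
  also have "\<dots> = (\<integral>\<^sup>+ x. f (c + x) \<partial>lborel)"
    by (subst nn_integral_distr) auto
  finally show ?thesis ..
qed

lemma nn_integral_lborel_scale:
  fixes f :: "'a::euclidean_space \<Rightarrow> ennreal"
  assumes [measurable]: "f \<in> borel_measurable borel" and "r > 0"
  shows "(\<integral>\<^sup>+ x. f x \<partial>lborel) = ennreal (r ^ DIM('a)) * (\<integral>\<^sup>+ x. f (r *\<^sub>R x) \<partial>lborel)"
  using assms(2)
  by (subst lborel_affine[of r 0]) (auto simp: nn_integral_density nn_integral_distr nn_integral_cmult)

lemma nn_integral_heis:
  fixes f :: "'n::finite heis \<Rightarrow> ennreal"
  assumes [measurable]: "f \<in> borel_measurable borel"
  shows "(\<integral>\<^sup>+ x. f x \<partial>lborel) = (\<integral>\<^sup>+ a. \<integral>\<^sup>+ b. \<integral>\<^sup>+ t. f (a, b, t) \<partial>lborel \<partial>lborel \<partial>lborel)"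
proof -
  have [measurable]: "f \<in> borel_measurable (borel \<Otimes>\<^sub>M borel \<Otimes>\<^sub>M borel)"
    using assms by (simp add: borel_prod)
  have "(\<integral>\<^sup>+ x. f x \<partial>lborel) = (\<integral>\<^sup>+ x. f x \<partial>(lborel \<Otimes>\<^sub>M (lborel \<Otimes>\<^sub>M lborel)))"
    by (simp add: lborel_prod)
  also have "\<dots> = (\<integral>\<^sup>+ a. \<integral>\<^sup>+ x. f (a, x) \<partial>(lborel \<Otimes>\<^sub>M lborel) \<partial>lborel)"
    by (subst lborel_prod, subst lborel.nn_integral_fst[symmetric]) (auto simp: lborel_prod borel_prod)
  also have "\<dots> = (\<integral>\<^sup>+ a. \<integral>\<^sup>+ b. \<integral>\<^sup>+ t. f (a, b, t) \<partial>lborel \<partial>lborel \<partial>lborel)"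
    by (intro nn_integral_cong, subst lborel.nn_integral_fst[symmetric]) auto
  finally show ?thesis .
qed

lemma lborel_left_invariant_heis_mult:
  fixes x :: "'n::finite heis"
  shows "distr lborel borel (heis_mult x) = lborel"
proof (rule measure_eqI)
  fix A :: "'n heis set" assume "A \<in> sets (distr lborel borel (heis_mult x))"
  then have [measurable]: "A \<in> sets borel" by simp
  obtain a b t where x: "x = (a, b, t)" by (cases x)
  have "continuous_on UNIV (heis_mult x)"
    unfolding heis_mult_def x split_def by (auto intro!: continuous_intros)
  then have [measurable]: "heis_mult x \<in> borel_measurable borel"
    by (rule borel_measurable_continuous_onI)
  have [measurable]: "Pair u \<in> borel_measurable borel" for u :: "real ^ 'n"
    by (auto intro!: borel_measurable_continuous_onI continuous_intros)
  let ?I = "indicator A :: 'n heis \<Rightarrow> ennreal"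
  have I3: "(\<lambda>s. ?I (u, v, s)) \<in> borel_measurable borel" for u v
  proof -
    have "(\<lambda>s. (u, v, s)) \<in> borel_measurable borel" for u v :: "real ^ 'n" 
      by (auto intro!: borel_measurable_continuous_onI continuous_intros)
    then show ?thesis by measurable
  qed
  have [measurable]: "(\<lambda>z. ?I (fst z, fst (snd z), snd (snd z))) \<in> borel_measurable borel"
    by simp
  have J[measurable]: "(\<lambda>z. ?I z) \<in> borel_measurable (borel \<Otimes>\<^sub>M borel \<Otimes>\<^sub>M borel)"
    by (simp add: borel_prod)
  have shift: "(\<integral>\<^sup>+ s. ?I (u, v, t + s + c) \<partial>lborel) = (\<integral>\<^sup>+ s. ?I (u, v, s) \<partial>lborel)" for u v c
    using nn_integral_lborel_add[OF I3, of u v "t + c"] by (simp add: ac_simps)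
  have "emeasure (distr lborel borel (heis_mult x)) A = (\<integral>\<^sup>+ y. ?I (heis_mult x y) \<partial>lborel)"
    by (simp flip: nn_integral_indicator add: nn_integral_distr)
  also have "\<dots> = (\<integral>\<^sup>+ a'. \<integral>\<^sup>+ b'. \<integral>\<^sup>+ t'. ?I (heis_mult x (a', b', t')) \<partial>lborel \<partial>lborel \<partial>lborel)"
    by (rule nn_integral_heis) measurable
  also have "\<dots> = (\<integral>\<^sup>+ a'. \<integral>\<^sup>+ b'. \<integral>\<^sup>+ t'. ?I (a + a', b + b', t') \<partial>lborel \<partial>lborel \<partial>lborel)"
    by (simp only: x heis_mult_def prod.case shift)
  also have "\<dots> = (\<integral>\<^sup>+ a'. \<integral>\<^sup>+ b'. \<integral>\<^sup>+ t'. ?I (a + a', b', t') \<partial>lborel \<partial>lborel \<partial>lborel)"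
    by (intro nn_integral_cong nn_integral_lborel_add[where f="\<lambda>b'. \<integral>\<^sup>+ t'. ?I (a + _, b', t') \<partial>lborel"]) measurable
  also have "\<dots> = (\<integral>\<^sup>+ a'. \<integral>\<^sup>+ b'. \<integral>\<^sup>+ t'. ?I (a', b', t') \<partial>lborel \<partial>lborel \<partial>lborel)"
    by (intro nn_integral_lborel_add[where f="\<lambda>a'. \<integral>\<^sup>+ b'. \<integral>\<^sup>+ t'. ?I (a', b', t') \<partial>lborel \<partial>lborel"]) measurable
  also have "\<dots> = (\<integral>\<^sup>+ y. ?I y \<partial>lborel)"
    by (rule nn_integral_heis[symmetric]) simp
  finally show "emeasure (distr lborel borel (heis_mult x)) A = emeasure lborel A"
    by (simp flip: nn_integral_indicator)
qed simp

lemma nn_integral_heis_dilate: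
  fixes f :: "'n::finite heis \<Rightarrow> ennreal"
  assumes [measurable]: "f \<in> borel_measurable borel" and r: "r > 0"
  shows "(\<integral>\<^sup>+ x. f x \<partial>lborel) =
    ennreal (r ^ heis_hdim TYPE('n)) * (\<integral>\<^sup>+ x. f (heis_dilate r x) \<partial>lborel)"
proof -
  have [measurable]: "f \<in> borel_measurable (borel \<Otimes>\<^sub>M borel \<Otimes>\<^sub>M borel)"
    by (simp add: borel_prod)
  let ?n = "CARD('n)"
  have [measurable]: "heis_dilate r \<in> borel_measurable (borel :: 'n heis measure)"
    unfolding heis_dilate_def split_def
    by (auto intro!: borel_measurable_continuous_onI continuous_intros)
  have 1: "(\<integral>\<^sup>+ t. f (a, b, t) \<partial>lborel) = ennreal (r\<^sup>2) * (\<integral>\<^sup>+ t. f (a, b, r\<^sup>2 * t) \<partial>lborel)" for a b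
    using r by (subst nn_integral_lborel_scale[where r="r\<^sup>2"]) auto
  have 2: "(\<integral>\<^sup>+ b. \<integral>\<^sup>+ t. f (a, b, r\<^sup>2 * t) \<partial>lborel \<partial>lborel) =
      ennreal (r ^ ?n) * (\<integral>\<^sup>+ b. \<integral>\<^sup>+ t. f (a, r *\<^sub>R b, r\<^sup>2 * t) \<partial>lborel \<partial>lborel)" for a
    using r by (subst nn_integral_lborel_scale[where r=r]) auto
  have 3: "(\<integral>\<^sup>+ a. \<integral>\<^sup>+ b. \<integral>\<^sup>+ t. f (a, r *\<^sub>R b, r\<^sup>2 * t) \<partial>lborel \<partial>lborel \<partial>lborel) =
      ennreal (r ^ ?n) *
        (\<integral>\<^sup>+ a. \<integral>\<^sup>+ b. \<integral>\<^sup>+ t. f (r *\<^sub>R a, r *\<^sub>R b, r\<^sup>2 * t) \<partial>lborel \<partial>lborel \<partial>lborel)"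
    using r by (subst nn_integral_lborel_scale[where r=r]) auto
  have pow: "ennreal (r\<^sup>2) * (ennreal (r ^ ?n) * (ennreal (r ^ ?n) * z)) = ennreal (r ^ heis_hdim TYPE('n)) * z" for z
  proof -
    have "r ^ heis_hdim TYPE('n) = r\<^sup>2 * (r ^ ?n * r ^ ?n)"
      by (simp only: heis_hdim_def mult_2 power_add) (rule mult.commute)
    then show ?thesis using r by (simp only: ennreal_mult zero_le_power less_imp_le mult_nonneg_nonneg mult.assoc)
  qed
  have "(\<integral>\<^sup>+ x. f x \<partial>lborel) = ennreal (r\<^sup>2) * (ennreal (r ^ ?n) * (ennreal (r ^ ?n) *
      (\<integral>\<^sup>+ a. \<integral>\<^sup>+ b. \<integral>\<^sup>+ t. f (r *\<^sub>R a, r *\<^sub>R b, r\<^sup>2 * t) \<partial>lborel \<partial>lborel \<partial>lborel)))"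
    by (simp add: nn_integral_heis 1 nn_integral_cmult 2 3)
  also have "(\<integral>\<^sup>+ a. \<integral>\<^sup>+ b. \<integral>\<^sup>+ t. f (r *\<^sub>R a, r *\<^sub>R b, r\<^sup>2 * t) \<partial>lborel \<partial>lborel \<partial>lborel) =
      (\<integral>\<^sup>+ x. f (heis_dilate r x) \<partial>lborel)"
    by (subst nn_integral_heis) (measurable, simp add: heis_dilate_def)
  finally show ?thesis unfolding pow .
qed

lemma heis_norm_nonneg [simp]: "heis_norm x \<ge> 0"
  by (auto simp: heis_norm_def split_def)

lemma heis_norm_eq_0_iff [simp]: "heis_norm x = 0 \<longleftrightarrow> x = 0"
proof -
  obtain a b t where x: "x = (a, b, t)" by (cases x)
  have "heis_norm x = 0 \<longleftrightarrow> ((\<Sum>i\<in>UNIV. (a $ i)\<^sup>2) + (\<Sum>i\<in>UNIV. (b $ i)\<^sup>2) = 0 \<and> t = 0)"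
    by (simp add: heis_norm_def x sum_power2_eq_zero_iff)
  also have "\<dots> \<longleftrightarrow> x = 0"
    by (subst add_nonneg_eq_0_iff)
       (auto simp: sum_nonneg sum_nonneg_eq_0_iff x zero_prod_def vec_eq_iff)
  finally show ?thesis .
qed

lemma heis_norm_0 [simp]: "heis_norm 0 = 0"
  by simp

lemma heis_norm_dilate: "r \<ge> 0 \<Longrightarrow> heis_norm (heis_dilate r x) = r * heis_norm x"
proof -
  assume r: "r \<ge> 0"
  obtain a b t where x: "x = (a, b, t)" by (cases x)
  let ?A = "(\<Sum>i\<in>UNIV. (a $ i)\<^sup>2)" and ?B = "(\<Sum>i\<in>UNIV. (b $ i)\<^sup>2)"
  have "(r\<^sup>2 * ?A + r\<^sup>2 * ?B)\<^sup>2 + (r\<^sup>2 * t)\<^sup>2 = r ^ 4 * ((?A + ?B)\<^sup>2 + t\<^sup>2)"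
    by algebra
  then show ?thesis using r
    by (simp add: heis_norm_def heis_dilate_def x power_mult_distrib real_root_mult real_root_power_cancel
        flip: sum_distrib_left)
qed

lemma heis_dilate_dilate: "heis_dilate r (heis_dilate s x) = heis_dilate (r * s) x"
  by (simp add: heis_dilate_def split_def power_mult_distrib)

lemma heis_dilate_1 [simp]: "heis_dilate 1 x = x"
  by (simp add: heis_dilate_def split_def)

lemma continuous_on_heis_norm [continuous_intros]:
  "continuous_on S f \<Longrightarrow> continuous_on S (\<lambda>x. heis_norm (f x))"
  unfolding heis_norm_def split_def by (intro continuous_intros)

lemma heis_norm_measurable [measurable]: "heis_norm \<in> borel_measurable borel"
  by (auto intro!: borel_measurable_continuous_onI continuous_intros)

lemma heis_dilate_measurable [measurable]:
  "(\<lambda>z. heis_dilate (fst z) (snd z)) \<in> borel_measurable (borel \<Otimes>\<^sub>M (borel :: 'n::finite heis measure))"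
  unfolding heis_dilate_def split_def borel_prod
  by (auto intro!: borel_measurable_continuous_onI continuous_intros)

lemma heis_dilate_measurable2 [measurable (raw)]:
  "f \<in> borel_measurable M \<Longrightarrow> g \<in> borel_measurable M \<Longrightarrow>
     (\<lambda>x. heis_dilate (f x) (g x :: 'n::finite heis)) \<in> borel_measurable M"
  using measurable_compose[OF measurable_Pair heis_dilate_measurable, of f M g] by simp

lemma heis_sphere_borel [measurable]: "heis_sphere \<in> sets borel"
  unfolding heis_sphere_def by measurable

lemma nn_integral_power_Suc_tail:
  assumes "a > 0" "m > 0"
  shows "(\<integral>\<^sup>+ s\<in>{a<..}. ennreal (1 / s ^ Suc m) \<partial>lborel) = ennreal (1 / (real m * a ^ m))"
proof -
  have "(\<integral>\<^sup>+ s. ennreal (1 / s ^ Suc m) * indicator {a..} s \<partial>lborel) =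
      ennreal (0 - (- 1 / (real m * a ^ m)))"
  proof (rule nn_integral_FTC_atLeast)
    fix x assume "a \<le> x"
    with assms have x: "x > 0" by simp
    show "((\<lambda>s. - 1 / (real m * s ^ m)) has_real_derivative 1 / x ^ Suc m) (at x)"
      using assms x by (auto intro!: derivative_eq_intros simp: field_simps simp flip: power_Suc power_add)
    show "0 \<le> 1 / x ^ Suc m" using x by simp
  next
    have "((\<lambda>s. inverse (s ^ m) :: real) \<longlongrightarrow> 0) at_top"
      using assms by (intro tendsto_inverse_0_at_top filterlim_pow_at_top filterlim_ident) auto
    from tendsto_mult_right_zero[OF this, of "- 1 / real m"]
    show "((\<lambda>s. - 1 / (real m * s ^ m)) \<longlongrightarrow> 0) at_top"
      by (simp add: field_simps)
  qed simp
  moreover have "(\<integral>\<^sup>+ s. ennreal (1 / s ^ Suc m) * indicator {a..} s \<partial>lborel) =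
      (\<integral>\<^sup>+ s\<in>{a<..}. ennreal (1 / s ^ Suc m) \<partial>lborel)"
    by (intro nn_integral_cong_AE eventually_mono[OF AE_lborel_singleton[of a]]) (auto simp: indicator_def)
  ultimately show ?thesis by simp
qed

lemma nn_integral_power_unit:
  assumes "m > 0"
  shows "(\<integral>\<^sup>+ s\<in>{0<..}. (c * indicator {..<1} s) * ennreal (s ^ (m - 1)) \<partial>lborel) = c * ennreal (1 / real m)"
proof -
  have "(\<integral>\<^sup>+ s. ennreal (s ^ (m - 1)) * indicator {0..1} s \<partial>lborel) = ennreal (1 ^ m / real m - 0 ^ m / real m)"
    using assms by (intro nn_integral_FTC_Icc) (auto intro!: derivative_eq_intros)
  moreover have "(\<integral>\<^sup>+ s\<in>{0<..}. (c * indicator {..<1} s) * ennreal (s ^ (m - 1)) \<partial>lborel) =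
     (\<integral>\<^sup>+ s. c * (ennreal (s ^ (m - 1)) * indicator {0..1} s) \<partial>lborel)"
    by (intro nn_integral_cong_AE eventually_mono[OF eventually_conj[OF AE_lborel_singleton[of 0] AE_lborel_singleton[of 1]]])
       (auto simp: indicator_def ac_simps)
  ultimately show ?thesis using assms by (simp add: nn_integral_cmult power_0_left)
qed

lemma indicator_greaterThan_measurable [measurable (raw)]:
  fixes u v :: "'a \<Rightarrow> real"
  assumes [measurable]: "u \<in> borel_measurable M" "v \<in> borel_measurable M"
  shows "(\<lambda>z. indicator {u z<..} (v z) :: ennreal) \<in> borel_measurable M"
proof -
  have "(\<lambda>z. indicator {u z<..} (v z) :: ennreal) = (\<lambda>z. if u z < v z then 1 else 0)"
    by (auto simp: indicator_def)
  then show ?thesis by simp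
qed

lemma ex1_heis_polar_measure: "\<exists>!\<sigma> :: 'n::finite heis measure. is_heis_polar_measure \<sigma>"
proof (rule ex_ex1I)
  let ?Q = "heis_hdim TYPE('n)"
  have Q: "?Q > 0" by (simp add: heis_hdim_def)
  define B :: "'n heis set" where "B = {x. 0 < heis_norm x \<and> heis_norm x < 1}"
  define P :: "'n heis \<Rightarrow> 'n heis" where "P = (\<lambda>x. heis_dilate (1 / heis_norm x) x)"
  have [measurable]: "B \<in> sets borel" unfolding B_def by measurable
  have Pb: "P \<in> borel_measurable borel" unfolding P_def by measurable
  have PS: "P x \<in> heis_sphere" if "x \<in> B" for x
    using that by (auto simp: P_def heis_sphere_def heis_norm_dilate B_def)
  have P[measurable]: "P \<in> measurable (restrict_space borel B) (restrict_space borel heis_sphere)"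
    by (rule measurable_restrict_space3[OF Pb]) (use PS in auto)
  define \<sigma>0 where "\<sigma>0 = distr (restrict_space lborel B) (restrict_space borel heis_sphere) P"
  define \<sigma> where "\<sigma> = scale_measure (ennreal ?Q) \<sigma>0"
  have P'[measurable]: "P \<in> measurable (restrict_space lborel B) (restrict_space borel heis_sphere)"
    using P by (simp cong: measurable_cong_sets add: sets_restrict_space)
  have "(\<integral>\<^sup>+ x. f x \<partial>lborel) =
        (\<integral>\<^sup>+ r\<in>{0<..}. (\<integral>\<^sup>+ \<theta>. f (heis_dilate r \<theta>) \<partial>\<sigma>) * ennreal (r ^ (?Q - 1)) \<partial>lborel)"
    if [measurable]: "f \<in> borel_measurable borel" for f :: "'n heis \<Rightarrow> ennreal"
  proof -
    define W where "W = (\<lambda>r. ennreal (r ^ (?Q - 1)) * indicator {0<..} r)"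
    have [measurable]: "W \<in> borel_measurable borel" unfolding W_def by measurable
    have in_sphere: "(\<lambda>\<theta>. f (heis_dilate r \<theta>)) \<in> borel_measurable (restrict_space borel heis_sphere)" for r
      by (rule measurable_restrict_space1) measurable
    have 1: "(\<integral>\<^sup>+ \<theta>. f (heis_dilate r \<theta>) \<partial>\<sigma>) =
        ennreal ?Q * (\<integral>\<^sup>+ x. f (heis_dilate (r / heis_norm x) x) * indicator B x \<partial>lborel)" for r
      unfolding \<sigma>_def
      apply (subst nn_integral_scale_measure)
      subgoal using in_sphere by (simp add: \<sigma>0_def)
      unfolding \<sigma>0_def
      apply (subst nn_integral_distr[OF P'], simp add: in_sphere)
      apply (subst nn_integral_restrict_space)
      apply (simp_all add: P_def heis_dilate_dilate)
      done
    have 2: "(\<integral>\<^sup>+ r. W r * f (heis_dilate (r / heis_norm x) x) \<partial>lborel) =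
       ennreal (heis_norm x ^ ?Q) * (\<integral>\<^sup>+ s. W s * f (heis_dilate s x) \<partial>lborel)" if "x \<in> B" for x
    proof -
      have x: "heis_norm x > 0" using that by (simp add: B_def)
      have W: "W (heis_norm x * s) = ennreal (heis_norm x ^ (?Q - 1)) * W s" for s
        using x by (auto simp: W_def indicator_def power_mult_distrib ennreal_mult' zero_less_mult_iff)
      have pw: "W (heis_norm x * s) * f (heis_dilate (heis_norm x * s / heis_norm x) x) =
          ennreal (heis_norm x ^ (?Q - 1)) * (W s * f (heis_dilate s x))" for s
        using x by (auto simp: W mult.assoc)
      have "(\<integral>\<^sup>+ r. W r * f (heis_dilate (r / heis_norm x) x) \<partial>lborel) =
        ennreal (heis_norm x ^ 1) * (\<integral>\<^sup>+ s. ennreal (heis_norm x ^ (?Q - 1)) * (W s * f (heis_dilate s x)) \<partial>lborel)"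
        by (subst nn_integral_lborel_scale[OF _ x]) (measurable, simp only: pw real_scaleR_def DIM_real)
      also have "\<dots> = ennreal (heis_norm x ^ 1) * ennreal (heis_norm x ^ (?Q - 1)) * (\<integral>\<^sup>+ s. W s * f (heis_dilate s x) \<partial>lborel)"
        by (subst nn_integral_cmult) (auto simp: ac_simps)
      also have "ennreal (heis_norm x ^ 1) * ennreal (heis_norm x ^ (?Q - 1)) = ennreal (heis_norm x ^ ?Q)"
        using Q by (simp flip: ennreal_mult' power_Suc)
      finally show ?thesis .
    qed
    have 3: "W s * (\<integral>\<^sup>+ x. f (heis_dilate s x) * ennreal (heis_norm x ^ ?Q) * indicator B x \<partial>lborel) =
      (\<integral>\<^sup>+ y. f y * ennreal (heis_norm y ^ ?Q) * (indicator {0<..} (heis_norm y) *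
          (ennreal (1 / s ^ Suc ?Q) * indicator {heis_norm y<..} s)) \<partial>lborel)" for s
    proof (cases "s > 0")
      case False
      then have "W s = 0" by (simp add: W_def)
      moreover have "indicator {heis_norm y<..} s = (0::ennreal)" for y :: "'n heis"
        using False heis_norm_nonneg[of y] by (auto simp: indicator_def simp del: heis_norm_nonneg)
      ultimately show ?thesis by simp
    next
      case s: True
      have *: "f (heis_dilate s x) * ennreal (heis_norm (heis_dilate s x) ^ ?Q) * (indicator {0<..} (heis_norm (heis_dilate s x)) *
          (ennreal (1 / s ^ Suc ?Q) * indicator {heis_norm (heis_dilate s x)<..} s)) =
          ennreal (1 / s) * (f (heis_dilate s x) * ennreal (heis_norm x ^ ?Q) * indicator B x)" for x
      proof (cases "x \<in> B")
        case True
        then have x: "0 < heis_norm x" "heis_norm x < 1" by (auto simp: B_def)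
        have "(s * heis_norm x) ^ ?Q * (1 / s ^ Suc ?Q) = 1 / s * heis_norm x ^ ?Q"
          using s by (simp add: power_mult_distrib)
        then have "ennreal ((s * heis_norm x) ^ ?Q) * ennreal (1 / s ^ Suc ?Q) = ennreal (1 / s) * ennreal (heis_norm x ^ ?Q)"
          using s x by (metis ennreal_mult' less_imp_le mult_pos_pos zero_le_power divide_nonneg_nonneg zero_le_one)
        then show ?thesis
          using s x True by (simp add: heis_norm_dilate mult.assoc mult.left_commute del: power_Suc)
      next
        case False
        then have "indicator {0<..} (s * heis_norm x) * indicator {s * heis_norm x<..} s = (0::ennreal)"
          using s by (auto simp: B_def indicator_def zero_less_mult_iff)
        then show ?thesis
          using s False by (auto simp: heis_norm_dilate)
      qed
      have "ennreal (s ^ ?Q) * ennreal (1 / s) = W s"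
        using s Q by (auto simp: W_def simp flip: ennreal_mult') (cases ?Q; simp)
      moreover have "(\<integral>\<^sup>+ y. f y * ennreal (heis_norm y ^ ?Q) * (indicator {0<..} (heis_norm y) *
          (ennreal (1 / s ^ Suc ?Q) * indicator {heis_norm y<..} s)) \<partial>lborel) =
        ennreal (s ^ ?Q) * (\<integral>\<^sup>+ x. ennreal (1 / s) *
          (f (heis_dilate s x) * ennreal (heis_norm x ^ ?Q) * indicator B x) \<partial>lborel)"
        by (subst nn_integral_heis_dilate[OF _ s]) (measurable, simp only: *)
      moreover have "(\<integral>\<^sup>+ x. ennreal (1 / s) *
          (f (heis_dilate s x) * ennreal (heis_norm x ^ ?Q) * indicator B x) \<partial>lborel) =
        ennreal (1 / s) * (\<integral>\<^sup>+ x. f (heis_dilate s x) * ennreal (heis_norm x ^ ?Q) * indicator B x \<partial>lborel)"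
        by (rule nn_integral_cmult) measurable
      ultimately show ?thesis
        by (simp only: flip: mult.assoc)
    qed
    have "(\<integral>\<^sup>+ r\<in>{0<..}. (\<integral>\<^sup>+ \<theta>. f (heis_dilate r \<theta>) \<partial>\<sigma>) * ennreal (r ^ (?Q - 1)) \<partial>lborel) =
       (\<integral>\<^sup>+ r. ennreal ?Q * (\<integral>\<^sup>+ x. W r * f (heis_dilate (r / heis_norm x) x) * indicator B x \<partial>lborel) \<partial>lborel)"
    proof (rule nn_integral_cong)
      fix r :: real
      have "(\<integral>\<^sup>+ x. W r * (f (heis_dilate (r / heis_norm x) x) * indicator B x) \<partial>lborel) =
          W r * (\<integral>\<^sup>+ x. f (heis_dilate (r / heis_norm x) x) * indicator B x \<partial>lborel)"
        by (rule nn_integral_cmult) measurable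
      then show "(\<integral>\<^sup>+ \<theta>. f (heis_dilate r \<theta>) \<partial>\<sigma>) * ennreal (r ^ (?Q - 1)) * indicator {0<..} r =
          ennreal ?Q * (\<integral>\<^sup>+ x. W r * f (heis_dilate (r / heis_norm x) x) * indicator B x \<partial>lborel)"
        unfolding 1 mult.assoc by (simp only: W_def ac_simps)
    qed
    also have "\<dots> = ennreal ?Q * (\<integral>\<^sup>+ r. \<integral>\<^sup>+ x. W r * f (heis_dilate (r / heis_norm x) x) * indicator B x \<partial>lborel \<partial>lborel)"
      by (rule nn_integral_cmult) measurable
    also have "(\<integral>\<^sup>+ r. \<integral>\<^sup>+ x. W r * f (heis_dilate (r / heis_norm x) x) * indicator B x \<partial>lborel \<partial>lborel) =
       (\<integral>\<^sup>+ x. \<integral>\<^sup>+ r. W r * f (heis_dilate (r / heis_norm x) x) * indicator B x \<partial>lborel \<partial>lborel)"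
      by (rule lborel_pair.Fubini') measurable
    also have "\<dots> = (\<integral>\<^sup>+ x. \<integral>\<^sup>+ s. W s * (f (heis_dilate s x) * ennreal (heis_norm x ^ ?Q) * indicator B x) \<partial>lborel \<partial>lborel)"
    proof (rule nn_integral_cong)
      fix x :: "'n heis"
      show "(\<integral>\<^sup>+ r. W r * f (heis_dilate (r / heis_norm x) x) * indicator B x \<partial>lborel) =
        (\<integral>\<^sup>+ s. W s * (f (heis_dilate s x) * ennreal (heis_norm x ^ ?Q) * indicator B x) \<partial>lborel)"
      proof (cases "x \<in> B")
        case True
        then have "(\<integral>\<^sup>+ r. W r * f (heis_dilate (r / heis_norm x) x) * indicator B x \<partial>lborel) =
           ennreal (heis_norm x ^ ?Q) * (\<integral>\<^sup>+ s. W s * f (heis_dilate s x) \<partial>lborel)"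
          using 2 by simp
        also have "\<dots> = (\<integral>\<^sup>+ s. ennreal (heis_norm x ^ ?Q) * (W s * f (heis_dilate s x)) \<partial>lborel)"
          by (rule nn_integral_cmult[symmetric]) measurable
        finally show ?thesis using True by (simp add: ac_simps)
      qed simp
    qed
    also have "\<dots> = (\<integral>\<^sup>+ s. \<integral>\<^sup>+ x. W s * (f (heis_dilate s x) * ennreal (heis_norm x ^ ?Q) * indicator B x) \<partial>lborel \<partial>lborel)"
      by (rule lborel_pair.Fubini') measurable
    also have "\<dots> = (\<integral>\<^sup>+ s. \<integral>\<^sup>+ y. f y * ennreal (heis_norm y ^ ?Q) * (indicator {0<..} (heis_norm y) *
          (ennreal (1 / s ^ Suc ?Q) * indicator {heis_norm y<..} s)) \<partial>lborel \<partial>lborel)"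
      by (subst 3[symmetric], intro nn_integral_cong, rule nn_integral_cmult) measurable
    also have "\<dots> = (\<integral>\<^sup>+ y. \<integral>\<^sup>+ s. f y * ennreal (heis_norm y ^ ?Q) * (indicator {0<..} (heis_norm y) *
          (ennreal (1 / s ^ Suc ?Q) * indicator {heis_norm y<..} s)) \<partial>lborel \<partial>lborel)"
      by (rule lborel_pair.Fubini') measurable
    also have "ennreal ?Q * \<dots> = (\<integral>\<^sup>+ y. ennreal ?Q * \<integral>\<^sup>+ s. f y * ennreal (heis_norm y ^ ?Q) * (indicator {0<..} (heis_norm y) *
          (ennreal (1 / s ^ Suc ?Q) * indicator {heis_norm y<..} s)) \<partial>lborel \<partial>lborel)"
      by (rule nn_integral_cmult[symmetric]) measurable
    also have "\<dots> = (\<integral>\<^sup>+ y. f y \<partial>lborel)"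
    proof (intro nn_integral_cong_AE eventually_mono[OF AE_lborel_singleton[of 0]])
      fix y :: "'n heis" assume "y \<noteq> 0"
      then have y: "heis_norm y > 0"
        using heis_norm_nonneg[of y] heis_norm_eq_0_iff[of y] by linarith
      have "(\<integral>\<^sup>+ s. f y * ennreal (heis_norm y ^ ?Q) * (indicator {0<..} (heis_norm y) *
          (ennreal (1 / s ^ Suc ?Q) * indicator {heis_norm y<..} s)) \<partial>lborel) =
          f y * ennreal (heis_norm y ^ ?Q) * ennreal (1 / (real ?Q * heis_norm y ^ ?Q))"
      proof -
        have "indicator {0<..} (heis_norm y) = (1 :: ennreal)" using y by simp
        moreover have "(\<integral>\<^sup>+ s. f y * ennreal (heis_norm y ^ ?Q) *
            (ennreal (1 / s ^ Suc ?Q) * indicator {heis_norm y<..} s) \<partial>lborel) =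
          f y * ennreal (heis_norm y ^ ?Q) *
            (\<integral>\<^sup>+ s. ennreal (1 / s ^ Suc ?Q) * indicator {heis_norm y<..} s \<partial>lborel)"
          by (rule nn_integral_cmult) measurable
        ultimately show ?thesis
          by (simp only: nn_integral_power_Suc_tail[OF y Q] mult_1)
      qed
      also have "\<dots> = f y * ennreal (1 / ?Q)"
        using y \<open>y \<noteq> 0\<close> by (simp add: mult.assoc flip: ennreal_mult')
      finally show "ennreal ?Q * (\<integral>\<^sup>+ s. f y * ennreal (heis_norm y ^ ?Q) * (indicator {0<..} (heis_norm y) *
          (ennreal (1 / s ^ Suc ?Q) * indicator {heis_norm y<..} s)) \<partial>lborel) = f y"
        using Q by (simp add: mult.left_commute flip: ennreal_mult')
    qed
    finally show ?thesis ..
  qed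
  then have "is_heis_polar_measure \<sigma>"
    unfolding is_heis_polar_measure_def by (simp add: \<sigma>_def \<sigma>0_def)
  then show "\<exists>\<sigma> :: 'n heis measure. is_heis_polar_measure \<sigma>" ..
next
  fix \<sigma> \<tau> :: "'n heis measure"
  let ?Q = "heis_hdim TYPE('n)"
  have Q: "?Q > 0" by (simp add: heis_hdim_def)
  have cone: "(\<integral>\<^sup>+ x. indicator {x. 0 < heis_norm x \<and> heis_norm x < 1 \<and> heis_dilate (1 / heis_norm x) x \<in> A} x \<partial>lborel)
     = emeasure \<mu> A * ennreal (1 / ?Q)"
    if \<mu>: "is_heis_polar_measure \<mu>" and A: "A \<in> sets \<mu>" for \<mu> :: "'n heis measure" and A
  proof -
    have s: "sets \<mu> = sets (restrict_space borel heis_sphere)"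
      using \<mu> by (simp add: is_heis_polar_measure_def)
    then have sp: "space \<mu> = heis_sphere"
      by (auto dest: sets_eq_imp_space_eq simp: space_restrict_space)
    have [measurable]: "A \<in> sets borel"
      using A s by (auto simp: sets_restrict_space)
    let ?I = "indicator {x :: 'n heis. 0 < heis_norm x \<and> heis_norm x < 1 \<and> heis_dilate (1 / heis_norm x) x \<in> A} :: _ \<Rightarrow> ennreal"
    have "?I \<in> borel_measurable borel"
      by measurable
    then have "(\<integral>\<^sup>+ x. ?I x \<partial>lborel) =
      (\<integral>\<^sup>+ r\<in>{0<..}. (\<integral>\<^sup>+ \<theta>. ?I (heis_dilate r \<theta>) \<partial>\<mu>) * ennreal (r ^ (?Q - 1)) \<partial>lborel)"
      using \<mu> unfolding is_heis_polar_measure_def by blast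
    also have "\<dots> = (\<integral>\<^sup>+ r\<in>{0<..}. (emeasure \<mu> A * indicator {..<1} r) * ennreal (r ^ (?Q - 1)) \<partial>lborel)"
    proof (rule nn_integral_cong)
      fix r :: real
      have "(\<integral>\<^sup>+ \<theta>. ?I (heis_dilate r \<theta>) \<partial>\<mu>) = (\<integral>\<^sup>+ \<theta>. indicator {..<1} r * indicator A \<theta> \<partial>\<mu>)" if "r > 0"
        using that by (intro nn_integral_cong)
          (auto simp: sp heis_sphere_def heis_norm_dilate heis_dilate_dilate indicator_def)
      then show "(\<integral>\<^sup>+ \<theta>. ?I (heis_dilate r \<theta>) \<partial>\<mu>) * ennreal (r ^ (?Q - 1)) * indicator {0<..} r =
        emeasure \<mu> A * indicator {..<1} r * ennreal (r ^ (?Q - 1)) * indicator {0<..} r"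
        unfolding nn_integral_cmult_indicator[OF A] by (cases "r > 0") (auto simp: mult.commute)
    qed
    also have "\<dots> = emeasure \<mu> A * ennreal (1 / ?Q)"
      by (rule nn_integral_power_unit[OF Q])
    finally show ?thesis .
  qed
  assume \<sigma>: "is_heis_polar_measure \<sigma>" and \<tau>: "is_heis_polar_measure \<tau>"
  then have sets: "sets \<sigma> = sets \<tau>" by (simp add: is_heis_polar_measure_def)
  show "\<sigma> = \<tau>"
  proof (rule measure_eqI[OF sets])
    fix A assume A: "A \<in> sets \<sigma>"
    have "emeasure \<sigma> A * ennreal (1 / ?Q) = emeasure \<tau> A * ennreal (1 / ?Q)"
      using cone[OF \<sigma> A] cone[OF \<tau>, of A] A sets by simp
    then have "emeasure \<sigma> A * ennreal (1 / ?Q) * ennreal ?Q = emeasure \<tau> A * ennreal (1 / ?Q) * ennreal ?Q"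
      by simp
    then show "emeasure \<sigma> A = emeasure \<tau> A"
      using Q by (simp add: mult.assoc flip: ennreal_mult')
  qed
qed

lemma is_heis_polar_measure_heis_sphere_measure:
  "is_heis_polar_measure (heis_sphere_measure :: 'n::finite heis measure)"
  unfolding heis_sphere_measure_def by (rule theI'[OF ex1_heis_polar_measure])

end

(* The function H f is radial and is bounded by the one-dimensional kernel 1 / max (r^Q) (s^Q) acting on
   the spherical integrals F(s) of |f| with respect to r^(Q-1) dr.  Hoelder's inequality on the sphere
   bounds F by the inner norm of f, and Schur's test with the weight s^(-a), a = Q/p, gives the upper
   bound with C = 1/(Q-a) + 1/a, which is the radial integral in G.

   For the lower bound take f(x) = phi(|x|_h), phi(s) = s^(-a) min(s^e, s^(-e)).  Since
   phi(s) >= phi(r) phi(s/r), H f dominates omega_Q (1/(Q-a+e) + 1/(a+e)) phi pointwise, and e -> 0 gives G.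
   This also works for p = 1 and p = infinity, where the bound blows up like 1/e and both sides of the
   asserted equality are infinite. *)
theory Submission
  imports Defs
begin

text \<open>The power of omega_Q in G collects two independent effects. Hoelder on the sphere costs
  omega_Q^(1 - 1/p1), and the angular norm of the radial function that bounds H f costs
  omega_Q^(1/p2). Their product is omega_Q^(1/p2 - 1/p1) times one more omega_Q, which is the factor
  that polar coordinates extract from the group integral in G. Neither effect depends on p, so
  sharpness is decided in one radial variable.

  The exponent a = Q/p is the critical one: the p-th power of r^(-a), times r^(Q-1) dr, is the
  dilation-invariant dr/r. Hence r^(-a) misses L^p at 0 and at infinity alike, and a near-extremal
  function has to be damped at both ends. The same exponent makes the two halves of Schur's test
  produce the same constant C, so nothing is lost in the upper bound.

  The norm estimates are carried out in \<open>ennreal\<close> and precede every statement about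
  convergence; integrability of the integrand is deduced from finiteness of the same
  quantities.\<close>

section \<open>Powers of extended nonnegative reals and a weighted Jensen inequality\<close>

lemma ennreal_powr_ennreal [simp]: "0 \<le> x \<Longrightarrow> ennreal_powr (ennreal x) a = ennreal (x powr a)"
  by (simp add: ennreal_powr_def)

lemma ennreal_powr_top [simp]: "ennreal_powr top a = top"
  by (simp add: ennreal_powr_def)

lemma ennreal_powr_0 [simp]: "ennreal_powr 0 a = 0"
  by (simp add: ennreal_powr_def)

lemma ennreal_powr_1 [simp]: "ennreal_powr x 1 = x"
  by (cases x) auto

lemma ennreal_powr_eq_0_iff [simp]: "ennreal_powr x a = 0 \<longleftrightarrow> x = 0"
  by (cases x) (auto simp: ennreal_eq_0_iff)

lemma ennreal_powr_less_top_iff [simp]: "ennreal_powr x a < top \<longleftrightarrow> x < top"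
  by (cases x) auto

lemma ennreal_powr_measurable [measurable]:
  assumes [measurable]: "f \<in> borel_measurable M"
  shows "(\<lambda>x. ennreal_powr (f x) a) \<in> borel_measurable M"
  unfolding ennreal_powr_def by measurable

lemma ennreal_powr_mono: "0 \<le> a \<Longrightarrow> x \<le> y \<Longrightarrow> ennreal_powr x a \<le> ennreal_powr y a"
  by (cases x; cases y) (auto intro!: ennreal_leI powr_mono2 simp: top_unique)

lemma ennreal_powr_mult: "ennreal_powr (x * y) a = ennreal_powr x a * ennreal_powr y a"
proof (cases x)
  case (real r)
  show ?thesis
  proof (cases y)
    case (real s)
    then show ?thesis using \<open>x = ennreal r\<close> \<open>0 \<le> r\<close>
      by (simp add: powr_mult flip: ennreal_mult)
  next
    case top
    then show ?thesis using \<open>x = ennreal r\<close> \<open>0 \<le> r\<close>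
      by (cases "r = 0") (auto simp: ennreal_mult_top)
  qed
next
  case top
  then show ?thesis by (cases "y = 0") (auto simp: ennreal_top_mult)
qed

lemma ennreal_powr_powr: "ennreal_powr (ennreal_powr x a) b = ennreal_powr x (a * b)"
  by (cases x) (auto simp: powr_powr)

text \<open>The convex function \<open>x powr p\<close> lies above its tangent at \<open>l\<close>;
  solving that inequality for \<open>x\<close> gives this bound, with equality at
  \<open>x = l\<close>. It is Young's inequality for the factors \<open>x / l\<close> and 1, scaled
  by \<open>l\<close>.\<close>

lemma Youngs_inequality_tangent:
  fixes x l p :: real
  assumes "0 \<le> x" "0 < l" "1 < p"
  shows "x \<le> l * (1 - 1 / p) + l powr (1 - p) * x powr p / p"
proof -
  define q where "q = 1 / (1 - 1 / p)"
  have q: "1 < q" "1 / p + 1 / q = 1" using assms by (auto simp: q_def field_simps)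
  have "x / l * 1 \<le> (x / l) powr p / p + 1 powr q / q"
    by (rule Youngs_inequality) (use assms q in auto)
  then have "l * (x / l) \<le> l * ((x / l) powr p / p + (1 - 1 / p))"
    using assms q by (intro mult_left_mono) (auto simp: algebra_simps)
  also have "\<dots> = l * (1 - 1 / p) + l powr (1 - p) * x powr p / p"
    using assms by (simp add: powr_divide powr_diff field_simps)
  finally show ?thesis using assms by simp
qed

text \<open>Jensen's inequality for the measure with density \<open>w\<close>, by integrating the tangent line of Young's
  inequality at the \<open>p\<close>-th mean of \<open>g\<close>.\<close>

lemma ennreal_powr_nn_integral_le:
  fixes w g :: "'a \<Rightarrow> ennreal"
  assumes [measurable]: "w \<in> borel_measurable M" "g \<in> borel_measurable M"
    and p: "1 < p" and W: "(\<integral>\<^sup>+ x. w x \<partial>M) < top"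
  shows "ennreal_powr (\<integral>\<^sup>+ x. w x * g x \<partial>M) p \<le>
    ennreal_powr (\<integral>\<^sup>+ x. w x \<partial>M) (p - 1) * (\<integral>\<^sup>+ x. w x * ennreal_powr (g x) p \<partial>M)"
proof -
  define W where "W = enn2real (\<integral>\<^sup>+ x. w x \<partial>M)"
  define S where "S = enn2real (\<integral>\<^sup>+ x. w x * ennreal_powr (g x) p \<partial>M)"
  have W_eq: "(\<integral>\<^sup>+ x. w x \<partial>M) = ennreal W" and W0: "W \<ge> 0" using W by (auto simp: W_def)
  \<comment> \<open>The tangent point chosen below requires \<open>W\<close> to be positive and the
    \<open>p\<close>-th moment of \<open>g\<close> to lie strictly between 0 and infinity. In the
    first degenerate case the left side is 0, in the second the right side is infinite.\<close>
  consider "W = 0 \<or> (\<integral>\<^sup>+ x. w x * ennreal_powr (g x) p \<partial>M) = 0"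
    | "W > 0" "(\<integral>\<^sup>+ x. w x * ennreal_powr (g x) p \<partial>M) = top"
    | "W > 0" "(\<integral>\<^sup>+ x. w x * ennreal_powr (g x) p \<partial>M) < top" "(\<integral>\<^sup>+ x. w x * ennreal_powr (g x) p \<partial>M) \<noteq> 0"
    using W0 less_top by fastforce
  then show ?thesis
  proof cases
    case 1
    have "AE x in M. w x * g x = 0"
    proof (cases "W = 0")
      case True
      with W_eq have "AE x in M. w x = 0" by (simp add: nn_integral_0_iff_AE)
      then show ?thesis by eventually_elim simp
    next
      case False
      with 1 have "AE x in M. w x * ennreal_powr (g x) p = 0"
        by (subst (asm) nn_integral_0_iff_AE) auto
      then show ?thesis by eventually_elim simp
    qed
    then have "(\<integral>\<^sup>+ x. w x * g x \<partial>M) = 0" by (simp add: nn_integral_0_iff_AE)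
    then show ?thesis by simp
  next
    case 2
    then show ?thesis using p by (simp add: W_eq ennreal_mult_top)
  next
    case 3
    have S_eq: "(\<integral>\<^sup>+ x. w x * ennreal_powr (g x) p \<partial>M) = ennreal S" and S: "S > 0"
      using 3 by (auto simp: S_def enn2real_positive_iff less_top zero_less_iff_neq_zero)
    \<comment> \<open>Since \<open>l powr p = S / W\<close>, the two terms of the tangent bound
      integrate to \<open>l * W * (1 - 1 / p)\<close> and \<open>l * W / p\<close>. They add up to
      \<open>l * W\<close>, whose \<open>p\<close>-th power is the claimed right side.\<close>
    define l where "l = (S / W) powr (1 / p)"
    have l: "l > 0" using S 3 by (simp add: l_def)
    have "(\<integral>\<^sup>+ x. w x * g x \<partial>M) \<le>
      (\<integral>\<^sup>+ x. ennreal (l * (1 - 1 / p)) * w x + ennreal (l powr (1 - p) / p) * (w x * ennreal_powr (g x) p) \<partial>M)"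
    proof (rule nn_integral_mono)
      fix x
      have "g x \<le> ennreal (l * (1 - 1 / p)) + ennreal (l powr (1 - p) / p) * ennreal_powr (g x) p"
      proof (cases "g x")
        case (real y)
        then have "g x \<le> ennreal (l * (1 - 1 / p) + l powr (1 - p) * y powr p / p)"
          unfolding real(2) using Youngs_inequality_tangent[of y l p] real l p by (intro ennreal_leI)
        also have "\<dots> = ennreal (l * (1 - 1 / p)) + ennreal (l powr (1 - p) / p) * ennreal_powr (g x) p"
          using real l p by (simp add: field_simps flip: ennreal_plus ennreal_mult)
        finally show ?thesis .
      next
        case top
        then show ?thesis using l p by (simp add: ennreal_mult_top)
      qed
      then have "w x * g x \<le> w x * (ennreal (l * (1 - 1 / p)) + ennreal (l powr (1 - p) / p) * ennreal_powr (g x) p)"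
        by (rule mult_left_mono) simp
      then show "w x * g x \<le>
        ennreal (l * (1 - 1 / p)) * w x + ennreal (l powr (1 - p) / p) * (w x * ennreal_powr (g x) p)"
        by (simp only: ring_distribs ac_simps)
    qed
    also have "\<dots> = ennreal (l * (1 - 1 / p)) * ennreal W + ennreal (l powr (1 - p) / p) * ennreal S"
      by (subst nn_integral_add) (auto simp: nn_integral_cmult W_eq S_eq)
    also have "\<dots> = ennreal (l * (1 - 1 / p) * W + l powr (1 - p) / p * S)"
      using l p W0 S by (simp flip: ennreal_plus ennreal_mult)
    also have "l * (1 - 1 / p) * W + l powr (1 - p) / p * S = l * W"
    proof -
      have "l powr (1 - p) * S = l * (l powr (- p) * S)"
        using l by (simp add: powr_diff powr_minus field_simps)
      also have "l powr (- p) = W / S"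
        using S 3 p by (simp add: l_def powr_powr powr_minus)
      finally have "l powr (1 - p) * S = l * W" using S by simp
      then show ?thesis by (simp add: algebra_simps diff_divide_distrib)
    qed
    finally have "ennreal_powr (\<integral>\<^sup>+ x. w x * g x \<partial>M) p \<le> ennreal_powr (ennreal (l * W)) p"
      using p by (intro ennreal_powr_mono) auto
    also have "\<dots> = ennreal (W powr (p - 1) * S)"
    proof -
      have "(l * W) powr p = W powr (p - 1) * S"
        using S 3 p l by (simp add: powr_mult l_def powr_powr powr_diff)
      then show ?thesis using l 3 by simp
    qed
    also have "\<dots> = ennreal_powr (\<integral>\<^sup>+ x. w x \<partial>M) (p - 1) * (\<integral>\<^sup>+ x. w x * ennreal_powr (g x) p \<partial>M)"
      using W0 S by (simp add: W_eq S_eq ennreal_mult)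
    finally show ?thesis .
  qed
qed

section \<open>The norms of one variable\<close>

lemma lp_enorm_mono:
  assumes "f \<in> borel_measurable M" "AE x in M. f x \<le> g x"
  shows "lp_enorm p M f \<le> lp_enorm p M g"
  using assms unfolding lp_enorm_def
  by (auto intro!: esssup_AE_mono ennreal_powr_mono nn_integral_mono_AE elim!: eventually_mono)

lemma lp_enorm_cong_AE:
  assumes "f \<in> borel_measurable M" "g \<in> borel_measurable M" "AE x in M. f x = g x"
  shows "lp_enorm p M f = lp_enorm p M g"
  using assms by (intro antisym lp_enorm_mono) (auto elim!: eventually_mono)

lemma lp_enorm_cmult:
  assumes [measurable]: "f \<in> borel_measurable M" and c: "0 < c" and p: "1 \<le> p"
  shows "lp_enorm p M (\<lambda>x. ennreal c * f x) = ennreal c * lp_enorm p M f"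
proof (cases "p = \<infinity>")
  case True
  \<comment> \<open>One inequality for all \<open>c\<close> and \<open>f\<close> suffices: the
    reverse one follows by applying it to the factor \<open>1 / c\<close> and the function
    \<open>ennreal c * f x\<close>.\<close>
  have le: "ennreal c * esssup M f \<le> esssup M (\<lambda>x. ennreal c * f x)"
    if c: "0 < c" and [measurable]: "f \<in> borel_measurable M" for c f
  proof -
    have "ennreal c * esssup M f \<le> ennreal c * (ennreal (1 / c) * esssup M (\<lambda>x. ennreal c * f x))"
    proof (intro mult_left_mono esssup_I)
      show "AE x in M. f x \<le> ennreal (1 / c) * esssup M (\<lambda>x. ennreal c * f x)"
        using esssup_AE[where M=M and f="\<lambda>x. ennreal c * f x"]
      proof eventually_elim
        case (elim x)
        then have "ennreal (1 / c) * (ennreal c * f x) \<le> ennreal (1 / c) * esssup M (\<lambda>x. ennreal c * f x)"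
          by (rule mult_left_mono) simp
        then show ?case using c by (simp flip: mult.assoc ennreal_mult)
      qed
    qed auto
    also have "\<dots> = esssup M (\<lambda>x. ennreal c * f x)"
      using c by (simp flip: mult.assoc ennreal_mult)
    finally show ?thesis .
  qed
  have "esssup M (\<lambda>x. ennreal c * f x) = ennreal c * (ennreal (1 / c) * esssup M (\<lambda>x. ennreal c * f x))"
    using c by (simp flip: mult.assoc ennreal_mult)
  also have "\<dots> \<le> ennreal c * esssup M (\<lambda>x. ennreal (1 / c) * (ennreal c * f x))"
    using c by (intro mult_left_mono le) auto
  also have "\<dots> = ennreal c * esssup M f"
    using c by (simp flip: mult.assoc ennreal_mult)
  finally show ?thesis using le[OF c assms(1)] True by (simp add: lp_enorm_def)
next
  case False
  have "enn2real p > 0"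
    using p False by (simp add: enn2real_positive_iff less_top order.strict_trans2[OF zero_less_one])
  then show ?thesis using c False
    by (simp add: lp_enorm_def ennreal_powr_mult nn_integral_cmult powr_powr)
qed

lemma lp_enorm_const:
  assumes M: "emeasure M (space M) = ennreal w" "0 < w" and p: "1 \<le> p"
  shows "lp_enorm p M (\<lambda>x. c) = ennreal (w powr enn2real (1 / p)) * c"
proof (cases "p = \<infinity>")
  case True
  \<comment> \<open>The exponent becomes 0 and the factor \<open>w powr 0\<close> is 1. Positivity
    of \<open>w\<close> matters here, because \<open>0 powr 0\<close> is 0.\<close>
  have "1 / p = 0" using True by simp
  with True M show ?thesis by (simp add: lp_enorm_def esssup_const)
next
  case False
  have q: "enn2real p > 0"
    using p False by (simp add: enn2real_positive_iff less_top order.strict_trans2[OF zero_less_one])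
  have "enn2real (1 / p) = 1 / enn2real p"
    using p False by (cases p) (auto simp: divide_ennreal ennreal_1[symmetric] simp del: ennreal_1)
  with q M False show ?thesis
    by (simp add: lp_enorm_def ennreal_powr_mult ennreal_powr_powr mult.commute)
qed

text \<open>Hoelder's inequality against the constant 1 on a space of total mass \<open>w\<close>,
  with the power of \<open>w\<close> kept on the left. For finite \<open>p > 1\<close> it is the
  weighted Jensen inequality with weight 1; at \<open>p = 1\<close> the exponent of \<open>w\<close>
  vanishes and both sides agree.\<close>

lemma nn_integral_le_lp_enorm:
  assumes M: "emeasure M (space M) = ennreal w" "0 < w" and p: "1 \<le> p"
    and [measurable]: "f \<in> borel_measurable M"
  shows "ennreal (w powr (enn2real (1 / p) - 1)) * (\<integral>\<^sup>+ x. f x \<partial>M) \<le> lp_enorm p M f"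
proof (cases "p = \<infinity>")
  case True
  have "1 / p = 0" using True by simp
  have "(\<integral>\<^sup>+ x. f x \<partial>M) \<le> (\<integral>\<^sup>+ x. esssup M f \<partial>M)"
    by (intro nn_integral_mono_AE esssup_AE)
  then have "ennreal (1 / w) * (\<integral>\<^sup>+ x. f x \<partial>M) \<le> ennreal (1 / w) * (\<integral>\<^sup>+ x. esssup M f \<partial>M)"
    by (rule mult_left_mono) simp
  also have "\<dots> = ennreal (1 / w) * ennreal w * esssup M f"
    by (simp add: M ac_simps)
  also have "\<dots> = esssup M f"
    using M by (simp flip: ennreal_mult)
  finally show ?thesis using True \<open>1 / p = 0\<close> M
    by (simp add: lp_enorm_def powr_minus field_simps)
next
  case False
  define q where "q = enn2real p"
  have pq: "p = ennreal q" using False by (simp add: q_def less_top)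
  have q: "1 \<le> q" using p unfolding pq by simp
  have inv: "enn2real (1 / p) = 1 / q"
    using q by (simp add: pq divide_ennreal ennreal_1[symmetric] del: ennreal_1)
  show ?thesis
  proof (cases "q = 1")
    case True
    then show ?thesis using M by (simp add: inv lp_enorm_def pq)
  next
    case False
    with q have q: "1 < q" by simp
    have "ennreal_powr (\<integral>\<^sup>+ x. f x \<partial>M) q \<le> ennreal (w powr (q - 1)) * (\<integral>\<^sup>+ x. ennreal_powr (f x) q \<partial>M)"
      using ennreal_powr_nn_integral_le[of "\<lambda>_. 1" M f q] q M by simp
    then have "ennreal_powr (ennreal_powr (\<integral>\<^sup>+ x. f x \<partial>M) q) (1 / q) \<le>
        ennreal_powr (ennreal (w powr (q - 1)) * (\<integral>\<^sup>+ x. ennreal_powr (f x) q \<partial>M)) (1 / q)"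
      using q by (intro ennreal_powr_mono) auto
    then have "(\<integral>\<^sup>+ x. f x \<partial>M) \<le> ennreal (w powr (1 - 1 / q)) * lp_enorm p M f"
      using q by (simp add: ennreal_powr_powr ennreal_powr_mult powr_powr lp_enorm_def pq diff_divide_distrib)
    then have "ennreal (w powr (1 / q - 1)) * (\<integral>\<^sup>+ x. f x \<partial>M) \<le>
       ennreal (w powr (1 / q - 1)) * (ennreal (w powr (1 - 1 / q)) * lp_enorm p M f)"
      by (rule mult_left_mono) simp
    also have "\<dots> = lp_enorm p M f"
      using M by (simp add: powr_add[symmetric] flip: mult.assoc ennreal_mult)
    finally show ?thesis by (simp add: inv)
  qed
qed

section \<open>The sphere and polar coordinates\<close>

lemma heis_hdim_pos [simp]: "0 < heis_hdim TYPE('n::finite)" "heis_hdim TYPE('n) \<noteq> 0"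
  by (simp_all add: heis_hdim_def)

lemma sets_heis_sphere_measure:
  "sets (heis_sphere_measure :: 'n::finite heis measure) = sets (restrict_space borel heis_sphere)"
  using is_heis_polar_measure_heis_sphere_measure[where 'n='n] by (simp add: is_heis_polar_measure_def)

lemma space_heis_sphere_measure [simp]:
  "space (heis_sphere_measure :: 'n::finite heis measure) = heis_sphere"
  using sets_eq_imp_space_eq[OF sets_heis_sphere_measure] by (simp add: space_restrict_space)

lemma measurable_heis_sphere_measure [measurable (raw)]:
  "f \<in> measurable borel N \<Longrightarrow> f \<in> measurable (heis_sphere_measure :: 'n::finite heis measure) N"
  using measurable_restrict_space1 measurable_cong_sets[OF sets_heis_sphere_measure refl] by blast

lemma nn_integral_heis_radial_measure:
  assumes "f \<in> borel_measurable borel"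
  shows "(\<integral>\<^sup>+ r. f r \<partial>heis_radial_measure TYPE('n::finite)) =
    (\<integral>\<^sup>+ r. ennreal (r ^ (heis_hdim TYPE('n) - 1)) * indicator {0<..} r * f r \<partial>lborel)"
  using assms unfolding heis_radial_measure_def by (subst nn_integral_density) auto

lemma sets_heis_radial_measure [simp, measurable_cong]:
  "sets (heis_radial_measure TYPE('n::finite)) = sets borel"
  by (simp add: heis_radial_measure_def)

lemma space_heis_radial_measure [simp]: "space (heis_radial_measure TYPE('n::finite)) = UNIV"
  by (simp add: heis_radial_measure_def)

text \<open>The density vanishes off the positive half-line. Pointwise comparisons of radial
  functions therefore never have to consider the default values of \<open>powr\<close> and division
  at \<open>r \<le> 0\<close>.\<close>

lemma AE_heis_radial_measure:
  assumes "\<And>r. 0 < r \<Longrightarrow> P r"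
  shows "AE r in heis_radial_measure TYPE('n::finite). P r"
  unfolding heis_radial_measure_def using assms
  by (subst AE_density) (auto simp: indicator_def intro!: AE_I2)

text \<open>A density with finite values keeps Lebesgue measure sigma-finite. This licenses the
  exchange of the two radial integrals in \<open>kernel_schur\<close>.\<close>

lemma sigma_finite_heis_radial_measure: "sigma_finite_measure (heis_radial_measure TYPE('n::finite))"
  unfolding heis_radial_measure_def
  by (subst sigma_finite_measure.sigma_finite_iff_density_finite[OF lborel.sigma_finite_measure_axioms])
     (auto simp: indicator_def intro!: AE_I2 ennreal_mult_less_top[THEN iffD2])

lemma nn_integral_heis_polar:
  fixes f :: "'n::finite heis \<Rightarrow> ennreal"
  assumes "f \<in> borel_measurable borel"
  shows "(\<integral>\<^sup>+ x. f x \<partial>lborel) =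
    (\<integral>\<^sup>+ r\<in>{0<..}. (\<integral>\<^sup>+ \<theta>. f (heis_dilate r \<theta>) \<partial>heis_sphere_measure) * ennreal (r ^ (heis_hdim TYPE('n) - 1)) \<partial>lborel)"
  using is_heis_polar_measure_heis_sphere_measure[where 'n='n] assms by (auto simp: is_heis_polar_measure_def)

text \<open>Both horizontal parts and the central coordinate have Euclidean size below 1, so by the
  triangle inequality the ball lies in a Euclidean ball of radius 3. Finiteness of the sphere
  measure rests on this.\<close>

lemma emeasure_heis_unit_ball_finite: "emeasure lborel {x :: 'n::finite heis. heis_norm x < 1} < top"
proof -
  have "norm x \<le> 3" if "heis_norm x < 1" for x :: "'n heis"
  proof -
    obtain a b t where x: "x = (a, b, t)" by (cases x)
    have sq: "(\<Sum>i\<in>UNIV. (v $ i)\<^sup>2) = (norm v)\<^sup>2" for v :: "real ^ 'n"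
      by (simp add: norm_vec_def L2_set_def sum_nonneg)
    have *: "((norm a)\<^sup>2 + (norm b)\<^sup>2)\<^sup>2 + t\<^sup>2 < 1"
      using that by (simp add: x heis_norm_def sq)
    have "((norm a)\<^sup>2 + (norm b)\<^sup>2)\<^sup>2 < 1\<^sup>2"
      unfolding one_power2 using * zero_le_power2[of t] by linarith
    moreover have "\<bar>t\<bar>\<^sup>2 < 1\<^sup>2"
      unfolding one_power2 power2_abs
      using * zero_le_power2[of "(norm a)\<^sup>2 + (norm b)\<^sup>2"] by linarith
    ultimately have 1: "(norm a)\<^sup>2 + (norm b)\<^sup>2 < 1" and t: "\<bar>t\<bar> < 1"
      by (blast intro: power2_less_imp_less zero_le_one)+
    then have "(norm a)\<^sup>2 < 1\<^sup>2" "(norm b)\<^sup>2 < 1\<^sup>2"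
      unfolding one_power2 using zero_le_power2[of "norm a"] zero_le_power2[of "norm b"] by linarith+
    then have "norm a < 1" "norm b < 1"
      by (blast intro: power2_less_imp_less zero_le_one)+
    with t show ?thesis
      using norm_Pair_le[of a "(b, t)"] norm_Pair_le[of b t] by (simp add: x)
  qed
  then have "{x :: 'n heis. heis_norm x < 1} \<subseteq> cball 0 3" by auto
  then have "emeasure lborel {x :: 'n heis. heis_norm x < 1} \<le> emeasure lborel (cball (0 :: 'n heis) 3)"
    by (rule emeasure_mono) simp
  also have "\<dots> < top"
    using emeasure_bounded_finite[of "cball (0 :: 'n heis) 3"] by simp
  finally show ?thesis .
qed

text \<open>Polar coordinates for the indicator of the unit ball give its volume as the mass of the
  sphere divided by Q, so the mass is finite. This must be known before \<open>heis_omega\<close>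
  can be trusted, as \<open>measure\<close> returns 0 on a set of infinite measure. A sphere of mass
  0 would make Lebesgue measure vanish.\<close>

lemma
  shows emeasure_heis_sphere:
      "emeasure (heis_sphere_measure :: 'n::finite heis measure) heis_sphere = ennreal (heis_omega TYPE('n))"
    and heis_omega_pos: "heis_omega TYPE('n) > 0"
proof -
  let ?\<sigma> = "heis_sphere_measure :: 'n heis measure" and ?Q = "heis_hdim TYPE('n)"
  have "emeasure lborel {x :: 'n heis. heis_norm x < 1} = (\<integral>\<^sup>+ x. indicator {x :: 'n heis. heis_norm x < 1} x \<partial>lborel)"
    by (rule nn_integral_indicator[symmetric]) auto
  also have "\<dots> = (\<integral>\<^sup>+ r\<in>{0<..}. (emeasure ?\<sigma> heis_sphere * indicator {..<1} r) * ennreal (r ^ (?Q - 1)) \<partial>lborel)"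
  proof (subst nn_integral_heis_polar, measurable, rule nn_integral_cong)
    fix r :: real
    have "(\<integral>\<^sup>+ \<theta>. indicator {x. heis_norm x < 1} (heis_dilate r \<theta>) \<partial>?\<sigma>) =
        (\<integral>\<^sup>+ \<theta>. indicator {..<1} r \<partial>?\<sigma>)" if "r > 0"
      using that by (intro nn_integral_cong) (auto simp: heis_sphere_def heis_norm_dilate indicator_def)
    then show "(\<integral>\<^sup>+ \<theta>. indicator {x. heis_norm x < 1} (heis_dilate r \<theta>) \<partial>?\<sigma>) * ennreal (r ^ (?Q - 1)) * indicator {0<..} r =
        emeasure ?\<sigma> heis_sphere * indicator {..<1} r * ennreal (r ^ (?Q - 1)) * indicator {0<..} r"
      by (cases "r > 0") (auto simp: mult.commute)
  qed
  also have "\<dots> = emeasure ?\<sigma> heis_sphere * ennreal (1 / ?Q)"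
    by (rule nn_integral_power_unit) simp
  finally have "emeasure ?\<sigma> heis_sphere < top"
    using emeasure_heis_unit_ball_finite[where 'n='n]
    by (auto simp: ennreal_mult_less_top ennreal_eq_0_iff less_top)
  then show eq: "emeasure ?\<sigma> heis_sphere = ennreal (heis_omega TYPE('n))"
    unfolding heis_omega_def by (subst emeasure_eq_ennreal_measure) auto
  have "emeasure ?\<sigma> heis_sphere \<noteq> 0"
  proof
    assume "emeasure ?\<sigma> heis_sphere = 0"
    then have "(\<integral>\<^sup>+ x. 1 \<partial>(lborel :: 'n heis measure)) = 0"
      by (subst nn_integral_heis_polar) auto
    then show False by simp
  qed
  then show "heis_omega TYPE('n) > 0"
    using eq by (auto simp: less_le heis_omega_def)
qed

lemma finite_heis_sphere_measure: "finite_measure (heis_sphere_measure :: 'n::finite heis measure)"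
  by (rule finite_measureI) (simp add: emeasure_heis_sphere)

lemma sphere_integral_measurable:
  fixes f :: "'n::finite heis \<Rightarrow> ennreal"
  assumes f: "f \<in> borel_measurable borel"
  shows "(\<lambda>r. \<integral>\<^sup>+ \<theta>. f (heis_dilate r \<theta>) \<partial>heis_sphere_measure) \<in> borel_measurable borel"
proof -
  interpret finite_measure "heis_sphere_measure :: 'n heis measure" by (rule finite_heis_sphere_measure)
  have "(\<lambda>z. snd z) \<in> measurable (borel \<Otimes>\<^sub>M (heis_sphere_measure :: 'n heis measure)) borel"
    by (intro measurable_compose[OF measurable_snd] measurable_heis_sphere_measure) simp
  then have "(\<lambda>z. f (heis_dilate (fst z) (snd z))) \<in> borel_measurable (borel \<Otimes>\<^sub>M (heis_sphere_measure :: 'n heis measure))"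
    by (intro measurable_compose[OF _ f] heis_dilate_measurable2 measurable_fst)
  then have "(\<lambda>(r, \<theta>). f (heis_dilate r \<theta>)) \<in> borel_measurable (borel \<Otimes>\<^sub>M (heis_sphere_measure :: 'n heis measure))"
    by (simp add: split_def)
  then show ?thesis by (rule borel_measurable_nn_integral)
qed

text \<open>On the sphere of radius \<open>r\<close> the weight is the constant \<open>k r\<close>
  and leaves the inner integral. With the kernel as weight, this is how H comes to depend on
  \<open>f\<close> only through its spherical integrals.\<close>

lemma nn_integral_heis_polar_weighted:
  fixes f :: "'n::finite heis \<Rightarrow> ennreal"
  assumes f [measurable]: "f \<in> borel_measurable borel" and k [measurable]: "k \<in> borel_measurable borel"
  shows "(\<integral>\<^sup>+ x. f x * k (heis_norm x) \<partial>lborel) =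
    (\<integral>\<^sup>+ r. (\<integral>\<^sup>+ \<theta>. f (heis_dilate r \<theta>) \<partial>heis_sphere_measure) * k r \<partial>heis_radial_measure TYPE('n))"
proof -
  have [measurable]: "(\<lambda>r. \<integral>\<^sup>+ \<theta>. f (heis_dilate r \<theta>) \<partial>heis_sphere_measure) \<in> borel_measurable borel"
    using f by (rule sphere_integral_measurable)
  have "(\<integral>\<^sup>+ \<theta>. f (heis_dilate r \<theta>) * k (heis_norm (heis_dilate r \<theta>)) \<partial>heis_sphere_measure) =
      (\<integral>\<^sup>+ \<theta>. f (heis_dilate r \<theta>) \<partial>heis_sphere_measure) * k r" if "r > 0" for r
  proof -
    have "(\<integral>\<^sup>+ \<theta>. f (heis_dilate r \<theta>) * k (heis_norm (heis_dilate r \<theta>)) \<partial>heis_sphere_measure) =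
      (\<integral>\<^sup>+ \<theta>. f (heis_dilate r \<theta>) * k r \<partial>heis_sphere_measure)"
      using that by (intro nn_integral_cong) (auto simp: heis_sphere_def heis_norm_dilate)
    also have "\<dots> = (\<integral>\<^sup>+ \<theta>. f (heis_dilate r \<theta>) \<partial>heis_sphere_measure) * k r"
      by (rule nn_integral_multc) measurable
    finally show ?thesis .
  qed
  then show ?thesis
    by (subst nn_integral_heis_polar, measurable, subst nn_integral_heis_radial_measure, measurable)
       (auto intro!: nn_integral_cong simp: indicator_def ac_simps)
qed

lemma nn_integral_heis_radial:
  assumes k [measurable]: "k \<in> borel_measurable borel"
  shows "(\<integral>\<^sup>+ x. k (heis_norm x) \<partial>(lborel :: 'n::finite heis measure)) =
    ennreal (heis_omega TYPE('n)) * (\<integral>\<^sup>+ r. k r \<partial>heis_radial_measure TYPE('n))"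
  using nn_integral_heis_polar_weighted[of "\<lambda>_ :: 'n heis. 1" k]
  by (simp add: emeasure_heis_sphere nn_integral_cmult)

text \<open>Covers negative \<open>r\<close> as well, so that the inner norm of a radial function in
  \<open>mixed_enorm_radial\<close> is known for every real \<open>r\<close> and not merely almost
  everywhere.\<close>

lemma heis_norm_dilate_abs: "heis_norm (heis_dilate r x) = \<bar>r\<bar> * heis_norm x"
proof -
  have "heis_norm (heis_dilate r x) = heis_norm (heis_dilate \<bar>r\<bar> x)"
    by (simp add: heis_norm_def heis_dilate_def split_def power_mult_distrib)
  then show ?thesis by (simp add: heis_norm_dilate)
qed

lemma lp_enorm_heis_sphere_const:
  "1 \<le> q \<Longrightarrow> lp_enorm q (heis_sphere_measure :: 'n::finite heis measure) (\<lambda>\<theta>. c) =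
    ennreal (heis_omega TYPE('n) powr enn2real (1 / q)) * c"
  by (rule lp_enorm_const) (simp_all add: emeasure_heis_sphere heis_omega_pos)

lemma mixed_enorm_radial:
  fixes f :: "'n::finite heis \<Rightarrow> complex" and \<phi> :: "real \<Rightarrow> real"
  assumes [measurable]: "f \<in> borel_measurable borel" "\<phi> \<in> borel_measurable borel"
    and p: "1 \<le> p" and q: "1 \<le> q"
    and f: "\<And>x. norm (f x) = \<phi> (heis_norm x)"
  shows "mixed_enorm p q f = ennreal (heis_omega TYPE('n) powr enn2real (1 / q)) *
    lp_enorm p (heis_radial_measure TYPE('n)) (\<lambda>r. ennreal (\<phi> \<bar>r\<bar>))"
proof -
  have "lp_enorm q heis_sphere_measure (\<lambda>\<theta>. ennreal (norm (f (heis_dilate r \<theta>)))) =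
      ennreal (heis_omega TYPE('n) powr enn2real (1 / q)) * ennreal (\<phi> \<bar>r\<bar>)" for r
  proof -
    have "lp_enorm q heis_sphere_measure (\<lambda>\<theta>. ennreal (norm (f (heis_dilate r \<theta>)))) =
        lp_enorm q (heis_sphere_measure :: 'n heis measure) (\<lambda>\<theta>. ennreal (\<phi> \<bar>r\<bar>))"
      by (rule lp_enorm_cong_AE) (auto simp: f heis_norm_dilate_abs heis_sphere_def intro!: AE_I2)
    then show ?thesis using q by (simp add: lp_enorm_heis_sphere_const)
  qed
  then show ?thesis
    using p heis_omega_pos[where 'n='n] by (simp add: mixed_enorm_def lp_enorm_cmult)
qed

section \<open>The radial kernel\<close>

text \<open>The Jacobian r^(Q-1) turns the integrand into the powers \<open>\<alpha> - 1\<close>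
  below \<open>r\<close> and \<open>- \<beta> - 1\<close> above it; positive \<open>\<alpha>\<close>
  and \<open>\<beta>\<close> mean convergence at 0 and at infinity. The constant C, the integral in
  G, and the kernel integrals and finite-\<open>p\<close> norms of the test functions all reduce to
  this formula.\<close>

lemma nn_integral_heis_radial_powr_pieces:
  fixes c d r \<alpha> \<beta> :: real
  defines "Q \<equiv> heis_hdim TYPE('n::finite)"
  assumes "0 < \<alpha>" "0 < \<beta>" "0 < r" "0 \<le> c" "0 \<le> d"
  shows "(\<integral>\<^sup>+ s. ennreal (if s \<le> r then c * s powr (\<alpha> - real Q) else d * s powr (- \<beta> - real Q)) \<partial>heis_radial_measure TYPE('n)) =
    ennreal (c * r powr \<alpha> / \<alpha> + d * r powr (- \<beta>) / \<beta>)"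
proof -
  have Q: "0 < Q" by (simp add: Q_def)
  have pw: "s ^ (Q - 1) * s powr (x - real Q) = s powr (x - 1)" if "s > 0" for s x :: real
  proof -
    have "s ^ (Q - 1) * s powr (x - real Q) = s powr (real (Q - 1)) * s powr (x - real Q)"
      using that by (simp add: powr_realpow)
    also have "\<dots> = s powr (x - 1)"
      using that Q by (simp add: powr_add[symmetric] of_nat_diff)
    finally show ?thesis .
  qed
  have "(\<integral>\<^sup>+ s. ennreal (if s \<le> r then c * s powr (\<alpha> - real Q) else d * s powr (- \<beta> - real Q)) \<partial>heis_radial_measure TYPE('n)) =
    (\<integral>\<^sup>+ s. ennreal c * ennreal (indicator {0..r} s * s powr (\<alpha> - 1)) +
       ennreal d * ennreal (indicator {r..} s * s powr (- \<beta> - 1)) \<partial>lborel)"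
    unfolding Q_def
  proof (subst nn_integral_heis_radial_measure, measurable, fold Q_def,
      intro nn_integral_cong_AE eventually_mono[OF AE_lborel_singleton[of r]])
    \<comment> \<open>The closed intervals \<open>{0..r}\<close> and \<open>{r..}\<close> overlap
      only in the null set \<open>s = r\<close>. The point \<open>s = 0\<close> of the first is
      harmless, as \<open>0 powr x\<close> is 0.\<close>
    fix s assume "s \<noteq> r"
    show "ennreal (s ^ (Q - 1)) * indicator {0<..} s *
        ennreal (if s \<le> r then c * s powr (\<alpha> - real Q) else d * s powr (- \<beta> - real Q)) =
      ennreal c * ennreal (indicator {0..r} s * s powr (\<alpha> - 1)) +
      ennreal d * ennreal (indicator {r..} s * s powr (- \<beta> - 1))"
    proof (cases "s > 0")
      case True
      have "ennreal (s ^ (Q - 1)) * ennreal (x * s powr (y - real Q)) = ennreal x * ennreal (s powr (y - 1))"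
        if "0 \<le> x" for x y
        using True that by (simp add: pw[symmetric] mult.left_commute flip: ennreal_mult)
      then show ?thesis using True \<open>s \<noteq> r\<close> assms by (auto simp: indicator_def)
    next
      case False
      then show ?thesis using \<open>0 < r\<close> by (auto simp: indicator_def)
    qed
  qed
  also have "\<dots> = ennreal c * (\<integral>\<^sup>+ s. ennreal (indicator {0..r} s * s powr (\<alpha> - 1)) \<partial>lborel) +
       ennreal d * (\<integral>\<^sup>+ s. ennreal (indicator {r..} s * s powr (- \<beta> - 1)) \<partial>lborel)"
    by (subst nn_integral_add) (auto simp: nn_integral_cmult)
  also have "(\<integral>\<^sup>+ s. ennreal (indicator {0..r} s * s powr (\<alpha> - 1)) \<partial>lborel) = ennreal (r powr \<alpha> / \<alpha>)"
    using nn_integral_has_integral_lebesgue[OF _ has_integral_powr_from_0[of "\<alpha> - 1" r]] assms by simp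
  also have "(\<integral>\<^sup>+ s. ennreal (indicator {r..} s * s powr (- \<beta> - 1)) \<partial>lborel) = ennreal (r powr (- \<beta>) / \<beta>)"
    using nn_integral_has_integral_lebesgue[OF _ has_integral_powr_to_inf[of "- \<beta> - 1" r]] assms by simp
  also have "ennreal c * ennreal (r powr \<alpha> / \<alpha>) + ennreal d * ennreal (r powr (- \<beta>) / \<beta>) =
     ennreal (c * r powr \<alpha> / \<alpha> + d * r powr (- \<beta>) / \<beta>)"
    using assms by (simp flip: ennreal_mult ennreal_plus)
  finally show ?thesis .
qed

lemma max_power_eq_powr:
  fixes r s :: real
  assumes "0 < r" "0 < s"
  shows "max (r ^ m) (s ^ m) = (if s \<le> r then r powr real m else s powr real m)"
  using assms by (auto simp: powr_realpow max_def power_mono intro!: antisym)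

lemma kernel_powr_eq:
  fixes r s :: real
  assumes "0 < r" "0 < s"
  shows "s powr x / max (r ^ m) (s ^ m) = (if s \<le> r then r powr (- real m) * s powr x else s powr (x - real m))"
  by (simp add: max_power_eq_powr[OF assms] powr_minus powr_diff divide_inverse)

text \<open>The kernel is homogeneous of degree -Q, which the measure compensates, so a power is
  mapped to a multiple of itself. The range \<open>s \<le> r\<close> contributes
  \<open>1 / (real Q - a)\<close> and the range above \<open>r\<close> contributes
  \<open>1 / a\<close>.\<close>

lemma nn_integral_kernel_powr:
  fixes r a :: real
  defines "Q \<equiv> heis_hdim TYPE('n::finite)"
  assumes "0 < r" "0 < a" "a < real Q"
  shows "(\<integral>\<^sup>+ s. ennreal (s powr (- a) / max (r ^ Q) (s ^ Q)) \<partial>heis_radial_measure TYPE('n)) =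
    ennreal (r powr (- a) * (1 / (real Q - a) + 1 / a))"
proof -
  have "(\<integral>\<^sup>+ s. ennreal (s powr (- a) / max (r ^ Q) (s ^ Q)) \<partial>heis_radial_measure TYPE('n)) =
    (\<integral>\<^sup>+ s. ennreal (if s \<le> r then r powr (- real Q) * s powr ((real Q - a) - real Q) else 1 * s powr (- a - real Q)) \<partial>heis_radial_measure TYPE('n))"
    using assms by (intro nn_integral_cong_AE AE_heis_radial_measure) (auto simp: kernel_powr_eq)
  also have "\<dots> = ennreal (r powr (- real Q) * r powr (real Q - a) / (real Q - a) + 1 * r powr (- a) / a)"
    using assms unfolding Q_def by (intro nn_integral_heis_radial_powr_pieces) auto
  also have "r powr (- real Q) * r powr (real Q - a) / (real Q - a) + 1 * r powr (- a) / a =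
      r powr (- a) * (1 / (real Q - a) + 1 / a)"
    using assms by (simp add: powr_add[symmetric] distrib_left)
  finally show ?thesis .
qed

section \<open>Schur's test for the radial kernel\<close>

context
  fixes p a C :: real and Q :: nat and \<nu> :: "real measure"
  defines "Q \<equiv> heis_hdim TYPE('n::finite)" and "\<nu> \<equiv> heis_radial_measure TYPE('n)"
    and "a \<equiv> real Q / p" and "C \<equiv> 1 / (real Q - a) + 1 / a"
  assumes p: "1 < p"
begin

lemma AE_nu: "(\<And>r. 0 < r \<Longrightarrow> P r) \<Longrightarrow> AE r in \<nu>. P r"
  unfolding \<nu>_def by (rule AE_heis_radial_measure)

lemma kernel_exponent: "0 < a" "a < real Q" "a * p = real Q"
  using p by (auto simp: a_def Q_def field_simps)

lemma kernel_const_pos: "0 < C"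
  using kernel_exponent by (simp add: C_def add_pos_pos)

text \<open>Jensen's inequality for \<open>F(s) s\<^sup>a\<close> and the weight \<open>s\<^sup>-\<^sup>a / max (r\<^sup>Q) (s\<^sup>Q)\<close>.\<close>

lemma kernel_jensen:
  assumes F: "F \<in> borel_measurable borel" and r: "0 < r"
  shows "ennreal_powr (\<integral>\<^sup>+ s. F s * ennreal (1 / max (r ^ Q) (s ^ Q)) \<partial>\<nu>) p \<le>
    ennreal (C powr (p - 1) * r powr (a - real Q)) *
    (\<integral>\<^sup>+ s. ennreal (s powr (real Q - a) / max (r ^ Q) (s ^ Q)) * ennreal_powr (F s) p \<partial>\<nu>)"
proof -
  note [measurable] = F
  have [measurable_cong]: "sets \<nu> = sets borel" by (simp add: \<nu>_def)
  define w where "w s = ennreal (s powr (- a) / max (r ^ Q) (s ^ Q))" for s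
  define g where "g s = ennreal (s powr a) * F s" for s
  have [measurable]: "w \<in> borel_measurable borel" "g \<in> borel_measurable borel"
    unfolding w_def g_def by measurable
  have W: "(\<integral>\<^sup>+ s. w s \<partial>\<nu>) = ennreal (r powr (- a) * C)"
    unfolding w_def C_def Q_def \<nu>_def using r kernel_exponent by (intro nn_integral_kernel_powr) (auto simp: Q_def)
  have "(\<integral>\<^sup>+ s. F s * ennreal (1 / max (r ^ Q) (s ^ Q)) \<partial>\<nu>) = (\<integral>\<^sup>+ s. w s * g s \<partial>\<nu>)"
  proof (intro nn_integral_cong_AE AE_nu)
    fix s :: real assume s: "0 < s"
    have "ennreal (1 / max (r ^ Q) (s ^ Q)) = ennreal (s powr (- a) / max (r ^ Q) (s ^ Q)) * ennreal (s powr a)"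
      using r s by (simp add: powr_add[symmetric] max_def flip: ennreal_mult)
    then show "F s * ennreal (1 / max (r ^ Q) (s ^ Q)) = w s * g s"
      by (simp add: w_def g_def ac_simps)
  qed
  also have "ennreal_powr \<dots> p \<le> ennreal_powr (\<integral>\<^sup>+ s. w s \<partial>\<nu>) (p - 1) * (\<integral>\<^sup>+ s. w s * ennreal_powr (g s) p \<partial>\<nu>)"
    using p by (intro ennreal_powr_nn_integral_le) (auto simp: W)
  also have "ennreal_powr (\<integral>\<^sup>+ s. w s \<partial>\<nu>) (p - 1) = ennreal (C powr (p - 1) * r powr (a - real Q))"
  proof -
    \<comment> \<open>The choice of \<open>a\<close> enters through \<open>a * p = real Q\<close>,
      here and again below, where the \<open>p\<close>-th power of \<open>s powr a\<close> is
      \<open>s powr real Q\<close>.\<close>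
    have "- a * (p - 1) = a - real Q" using kernel_exponent by (simp add: algebra_simps)
    then show ?thesis
      using r kernel_const_pos by (simp add: W powr_mult powr_powr mult.commute)
  qed
  also have "(\<integral>\<^sup>+ s. w s * ennreal_powr (g s) p \<partial>\<nu>) =
      (\<integral>\<^sup>+ s. ennreal (s powr (real Q - a) / max (r ^ Q) (s ^ Q)) * ennreal_powr (F s) p \<partial>\<nu>)"
  proof (intro nn_integral_cong_AE AE_nu)
    fix s :: real assume s: "0 < s"
    have "ennreal (s powr (- a) / max (r ^ Q) (s ^ Q)) * ennreal (s powr real Q) = ennreal (s powr (real Q - a) / max (r ^ Q) (s ^ Q))"
      using r s by (simp add: powr_add[symmetric] max_def flip: ennreal_mult)
    then show "w s * ennreal_powr (g s) p = ennreal (s powr (real Q - a) / max (r ^ Q) (s ^ Q)) * ennreal_powr (F s) p"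
      using s by (simp add: w_def g_def ennreal_powr_mult powr_powr kernel_exponent flip: mult.assoc)
  qed
  finally show ?thesis .
qed

text \<open>The integrated bound of Schur's test would give finiteness for almost every
  \<open>r\<close> only, whereas boundedness of H demands convergence at every nonzero point. So the
  weight in \<open>kernel_jensen\<close> is estimated pointwise by its maximum
  \<open>r powr (- a)\<close>, attained at \<open>s = r\<close>.\<close>

lemma kernel_integral_finite:
  assumes F: "F \<in> borel_measurable borel" and r: "0 < r" and fin: "(\<integral>\<^sup>+ s. ennreal_powr (F s) p \<partial>\<nu>) < top"
  shows "(\<integral>\<^sup>+ s. F s * ennreal (1 / max (r ^ Q) (s ^ Q)) \<partial>\<nu>) < top"
proof -
  note [measurable] = F
  have [measurable_cong]: "sets \<nu> = sets borel" by (simp add: \<nu>_def)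
  have "(\<integral>\<^sup>+ s. ennreal (s powr (real Q - a) / max (r ^ Q) (s ^ Q)) * ennreal_powr (F s) p \<partial>\<nu>) \<le>
    (\<integral>\<^sup>+ s. ennreal (r powr (- a)) * ennreal_powr (F s) p \<partial>\<nu>)"
  proof (intro nn_integral_mono_AE AE_nu)
    fix s :: real assume s: "0 < s"
    have "s powr (real Q - a) / max (r ^ Q) (s ^ Q) \<le> r powr (- a)"
    proof (cases "s \<le> r")
      case True
      have "r powr (- real Q) * s powr (real Q - a) \<le> r powr (- real Q) * r powr (real Q - a)"
        using r s True kernel_exponent by (intro mult_left_mono powr_mono2) auto
      also have "\<dots> = r powr (- a)" using r by (simp add: powr_add[symmetric])
      finally show ?thesis using r s True by (simp add: kernel_powr_eq)
    next
      case False
      then show ?thesis unfolding kernel_powr_eq[OF r s] using r kernel_exponent by (simp add: powr_mono2')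
    qed
    then show "ennreal (s powr (real Q - a) / max (r ^ Q) (s ^ Q)) * ennreal_powr (F s) p \<le> ennreal (r powr (- a)) * ennreal_powr (F s) p"
      by (intro mult_right_mono ennreal_leI) auto
  qed
  also have "\<dots> < top"
    using fin by (simp add: nn_integral_cmult ennreal_mult_less_top)
  finally have "ennreal_powr (\<integral>\<^sup>+ s. F s * ennreal (1 / max (r ^ Q) (s ^ Q)) \<partial>\<nu>) p < top"
    by (intro order.strict_trans1[OF kernel_jensen[OF F r]]) (simp add: ennreal_mult_less_top)
  then show ?thesis by simp
qed

text \<open>After integrating \<open>kernel_jensen\<close> over \<open>r\<close> and exchanging the
  integrals, the inner one is \<open>nn_integral_kernel_powr\<close> with \<open>real Q - a\<close>
  in place of \<open>a\<close>. C is invariant under this replacement, so the constants multiply to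
  C^(p-1) * C = C^p.\<close>

lemma kernel_schur:
  assumes F: "F \<in> borel_measurable borel"
  shows "(\<integral>\<^sup>+ r. ennreal_powr (\<integral>\<^sup>+ s. F s * ennreal (1 / max (r ^ Q) (s ^ Q)) \<partial>\<nu>) p \<partial>\<nu>) \<le>
    ennreal (C powr p) * (\<integral>\<^sup>+ s. ennreal_powr (F s) p \<partial>\<nu>)"
proof -
  note [measurable] = F
  have [measurable_cong]: "sets \<nu> = sets borel" by (simp add: \<nu>_def)
  interpret sigma_finite_measure \<nu> unfolding \<nu>_def by (rule sigma_finite_heis_radial_measure)
  interpret pair_sigma_finite \<nu> \<nu> ..
  have "(\<integral>\<^sup>+ r. ennreal_powr (\<integral>\<^sup>+ s. F s * ennreal (1 / max (r ^ Q) (s ^ Q)) \<partial>\<nu>) p \<partial>\<nu>) \<le>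
    (\<integral>\<^sup>+ r. ennreal (C powr (p - 1) * r powr (a - real Q)) *
      (\<integral>\<^sup>+ s. ennreal (s powr (real Q - a) / max (r ^ Q) (s ^ Q)) * ennreal_powr (F s) p \<partial>\<nu>) \<partial>\<nu>)"
    using kernel_jensen[OF F] by (intro nn_integral_mono_AE AE_nu)
  also have "\<dots> = (\<integral>\<^sup>+ r. \<integral>\<^sup>+ s. ennreal (C powr (p - 1) * r powr (a - real Q)) *
      (ennreal (s powr (real Q - a) / max (r ^ Q) (s ^ Q)) * ennreal_powr (F s) p) \<partial>\<nu> \<partial>\<nu>)"
    by (subst nn_integral_cmult) auto
  also have "\<dots> = (\<integral>\<^sup>+ s. \<integral>\<^sup>+ r. ennreal (C powr (p - 1) * r powr (a - real Q)) *
      (ennreal (s powr (real Q - a) / max (r ^ Q) (s ^ Q)) * ennreal_powr (F s) p) \<partial>\<nu> \<partial>\<nu>)"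
    by (rule Fubini') measurable
  also have "\<dots> = (\<integral>\<^sup>+ s. ennreal (C powr p) * ennreal_powr (F s) p \<partial>\<nu>)"
  proof (intro nn_integral_cong_AE AE_nu)
    fix s :: real assume s: "0 < s"
    let ?D = "C powr (p - 1) * s powr (real Q - a)"
    have "(\<integral>\<^sup>+ r. ennreal (C powr (p - 1) * r powr (a - real Q)) *
      (ennreal (s powr (real Q - a) / max (r ^ Q) (s ^ Q)) * ennreal_powr (F s) p) \<partial>\<nu>) =
      (\<integral>\<^sup>+ r. (ennreal ?D * ennreal_powr (F s) p) * ennreal (r powr (- (real Q - a)) / max (s ^ Q) (r ^ Q)) \<partial>\<nu>)"
      using s by (intro nn_integral_cong) 
        (simp add: max.commute mult.commute mult.left_commute ennreal_mult'[symmetric] flip: ennreal_mult)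
    also have "\<dots> = (ennreal ?D * ennreal_powr (F s) p) *
        ennreal (s powr (- (real Q - a)) * (1 / (real Q - (real Q - a)) + 1 / (real Q - a)))"
      unfolding \<nu>_def Q_def using s kernel_exponent
      by (subst nn_integral_cmult, measurable, subst nn_integral_kernel_powr) (auto simp: Q_def)
    also have "\<dots> = ennreal (?D * (s powr (- (real Q - a)) * C)) * ennreal_powr (F s) p"
      using kernel_const_pos by (simp add: C_def add.commute ennreal_mult ac_simps)
    also have "?D * (s powr (- (real Q - a)) * C) = C powr p"
    proof -
      have "?D * (s powr (- (real Q - a)) * C) = (C powr (p - 1) * C powr 1) * (s powr (real Q - a) * s powr (- (real Q - a)))"
        using kernel_const_pos by simp
      also have "\<dots> = C powr p"
        using s unfolding powr_add[symmetric] by simp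
      finally show ?thesis .
    qed
    finally show "(\<integral>\<^sup>+ r. ennreal (C powr (p - 1) * r powr (a - real Q)) *
      (ennreal (s powr (real Q - a) / max (r ^ Q) (s ^ Q)) * ennreal_powr (F s) p) \<partial>\<nu>) =
      ennreal (C powr p) * ennreal_powr (F s) p" .
  qed
  also have "\<dots> = ennreal (C powr p) * (\<integral>\<^sup>+ s. ennreal_powr (F s) p \<partial>\<nu>)"
    by (rule nn_integral_cmult) measurable
  finally show ?thesis .
qed

end

section \<open>The upper bound\<close>

lemma hlp_integrand_measurable:
  fixes f :: "'n::finite heis \<Rightarrow> complex"
  assumes [measurable]: "f \<in> borel_measurable borel"
  shows "(\<lambda>z. hlp_integrand f (fst z) (snd z)) \<in> borel_measurable (borel \<Otimes>\<^sub>M borel)"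
  unfolding hlp_integrand_def by measurable

lemma hlp_integrand_measurable' [measurable]:
  fixes f :: "'n::finite heis \<Rightarrow> complex"
  assumes [measurable]: "f \<in> borel_measurable borel"
  shows "hlp_integrand f x \<in> borel_measurable borel"
  unfolding hlp_integrand_def by measurable

lemma hlp_op_measurable:
  fixes f :: "'n::finite heis \<Rightarrow> complex"
  assumes "f \<in> borel_measurable borel"
  shows "hlp_op f \<in> borel_measurable borel"
proof -
  have "(\<lambda>(x, y). hlp_integrand f x y) \<in> borel_measurable (borel \<Otimes>\<^sub>M lborel)"
    using hlp_integrand_measurable[OF assms] by (simp add: split_def)
  from lborel.borel_measurable_lebesgue_integral[OF this]
  show ?thesis by (simp add: hlp_op_def[abs_def])
qed

lemma norm_hlp_integrand:
  fixes f :: "'n::finite heis \<Rightarrow> complex"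
  shows "norm (hlp_integrand f x y) =
    norm (f y) * (1 / max (heis_norm x ^ heis_hdim TYPE('n)) (heis_norm y ^ heis_hdim TYPE('n)))"
  by (auto simp: hlp_integrand_def norm_divide max_def)

lemma nn_integral_norm_hlp_integrand:
  fixes f :: "'n::finite heis \<Rightarrow> complex"
  assumes [measurable]: "f \<in> borel_measurable borel"
  shows "(\<integral>\<^sup>+ y. ennreal (norm (hlp_integrand f x y)) \<partial>lborel) =
    (\<integral>\<^sup>+ s. (\<integral>\<^sup>+ \<theta>. ennreal (norm (f (heis_dilate s \<theta>))) \<partial>heis_sphere_measure) *
      ennreal (1 / max (heis_norm x ^ heis_hdim TYPE('n)) (s ^ heis_hdim TYPE('n))) \<partial>heis_radial_measure TYPE('n))"
  unfolding norm_hlp_integrand ennreal_mult'[OF norm_ge_zero]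
  by (rule nn_integral_heis_polar_weighted[where k="\<lambda>s. ennreal (1 / max (heis_norm x ^ heis_hdim TYPE('n)) (s ^ heis_hdim TYPE('n)))"])
    measurable

text \<open>Without integrability the library integral is 0 and the bound is trivial, so norms of H
  f can be estimated before convergence is known.\<close>

lemma norm_hlp_op_le:
  "ennreal (norm (hlp_op f x)) \<le> (\<integral>\<^sup>+ y. ennreal (norm (hlp_integrand f x y)) \<partial>lborel)"
  unfolding hlp_op_def
  by (cases "integrable lborel (hlp_integrand f x)")
     (auto intro: integral_norm_bound_ennreal simp: not_integrable_integral_eq)

lemma enn2real_inverse_ennreal: "0 < P \<Longrightarrow> enn2real (1 / ennreal P) = 1 / P"
  by (simp add: divide_ennreal ennreal_1[symmetric] del: ennreal_1)

lemma lp_enorm_ennreal: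
  "0 < P \<Longrightarrow> lp_enorm (ennreal P) M g = ennreal_powr (\<integral>\<^sup>+ x. ennreal_powr (g x) P \<partial>M) (1 / P)"
  by (simp add: lp_enorm_def)

text \<open>\<open>N\<close> separates the two angular exponents:
  \<open>sphere_integral_enorm_le\<close> bounds it by the norm of \<open>f\<close> and serves the
  domain exponent, while \<open>hlp_op_enorm_le\<close> bounds H f by it and serves the target
  exponent.\<close>

context
  fixes f :: "'n::finite heis \<Rightarrow> complex" and P :: real and F :: "real \<Rightarrow> ennreal" and N :: ennreal and w a C :: real
  assumes f: "f \<in> borel_measurable borel" and P: "1 < P"
  defines "F \<equiv> \<lambda>r. \<integral>\<^sup>+ \<theta>. ennreal (norm (f (heis_dilate r \<theta>))) \<partial>heis_sphere_measure"
    and "N \<equiv> ennreal_powr (\<integral>\<^sup>+ r. ennreal_powr (F r) P \<partial>heis_radial_measure TYPE('n)) (1 / P)"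
    and "w \<equiv> heis_omega TYPE('n)"
    and "a \<equiv> real (heis_hdim TYPE('n)) / P" and "C \<equiv> 1 / (real (heis_hdim TYPE('n)) - a) + 1 / a"
begin

lemma F_measurable [measurable]: "F \<in> borel_measurable borel"
  unfolding F_def using f by (intro sphere_integral_measurable) measurable

text \<open>The constant stays on the side of \<open>N\<close>, so that the measurability in \<open>r\<close> of the inner norm of \<open>f\<close>
  never enters.\<close>

lemma sphere_integral_enorm_le:
  assumes q: "1 \<le> q"
  shows "ennreal (w powr (enn2real (1 / q) - 1)) * N \<le> mixed_enorm (ennreal P) q f"
proof -
  note [measurable] = f
  let ?c = "w powr (enn2real (1 / q) - 1)"
  have "ennreal ?c * N =
      ennreal_powr (\<integral>\<^sup>+ r. ennreal_powr (ennreal ?c * F r) P \<partial>heis_radial_measure TYPE('n)) (1 / P)"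
    using P by (simp add: N_def ennreal_powr_mult nn_integral_cmult powr_powr)
  also have "\<dots> \<le> mixed_enorm (ennreal P) q f"
    unfolding mixed_enorm_def lp_enorm_ennreal[OF order.strict_trans[OF zero_less_one P]]
  proof (rule ennreal_powr_mono[OF _ nn_integral_mono])
    fix r :: real
    have "ennreal ?c * F r \<le> lp_enorm q heis_sphere_measure (\<lambda>\<theta>. ennreal (norm (f (heis_dilate r \<theta>))))"
      unfolding F_def w_def using q heis_omega_pos[where 'n='n]
      by (intro nn_integral_le_lp_enorm) (auto simp: emeasure_heis_sphere)
    then show "ennreal_powr (ennreal ?c * F r) P \<le>
        ennreal_powr (lp_enorm q heis_sphere_measure (\<lambda>\<theta>. ennreal (norm (f (heis_dilate r \<theta>))))) P"
      using P by (simp add: ennreal_powr_mono)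
  qed (use P in auto)
  finally show ?thesis .
qed

text \<open>The majorant of |H f| at radius \<open>r\<close> is the number \<open>?K r\<close>,
  independent of the angle. For every \<open>q\<close> the inner norm is thus at most that of a
  constant, and \<open>kernel_schur\<close> controls the radial norm of \<open>?K\<close>.\<close>

lemma hlp_op_enorm_le:
  assumes q: "1 \<le> q"
  shows "mixed_enorm (ennreal P) q (hlp_op f) \<le> ennreal (w powr enn2real (1 / q) * C) * N"
proof -
  note [measurable] = f hlp_op_measurable[OF f]
  let ?c = "w powr enn2real (1 / q)" and ?\<nu> = "heis_radial_measure TYPE('n)" and ?Q = "heis_hdim TYPE('n)"
  let ?K = "\<lambda>r. \<integral>\<^sup>+ s. F s * ennreal (1 / max (r ^ ?Q) (s ^ ?Q)) \<partial>?\<nu>"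
  have C: "C > 0" unfolding C_def a_def using kernel_const_pos[OF P, where 'n='n] by simp
  have "mixed_enorm (ennreal P) q (hlp_op f) \<le> ennreal_powr (\<integral>\<^sup>+ r. ennreal (?c powr P) * ennreal_powr (?K r) P \<partial>?\<nu>) (1 / P)"
    unfolding mixed_enorm_def lp_enorm_ennreal[OF order.strict_trans[OF zero_less_one P]]
  proof (intro ennreal_powr_mono nn_integral_mono_AE AE_heis_radial_measure)
    fix r :: real assume r: "0 < r"
    have "lp_enorm q heis_sphere_measure (\<lambda>\<theta>. ennreal (norm (hlp_op f (heis_dilate r \<theta>)))) \<le>
      lp_enorm q (heis_sphere_measure :: 'n heis measure) (\<lambda>\<theta>. ?K r)"
    proof (rule lp_enorm_mono)
      show "AE \<theta> in (heis_sphere_measure :: 'n heis measure). ennreal (norm (hlp_op f (heis_dilate r \<theta>))) \<le> ?K r"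
      proof (rule AE_I2)
        fix \<theta> :: "'n heis" assume "\<theta> \<in> space heis_sphere_measure"
        then have n: "heis_norm (heis_dilate r \<theta>) = r"
          using r by (simp add: heis_sphere_def heis_norm_dilate)
        show "ennreal (norm (hlp_op f (heis_dilate r \<theta>))) \<le> ?K r"
          using norm_hlp_op_le[of f "heis_dilate r \<theta>"]
          unfolding nn_integral_norm_hlp_integrand[OF f] n F_def .
      qed
    qed auto
    then have "ennreal_powr (lp_enorm q heis_sphere_measure (\<lambda>\<theta>. ennreal (norm (hlp_op f (heis_dilate r \<theta>))))) P \<le>
      ennreal_powr (ennreal ?c * ?K r) P"
      using P q by (intro ennreal_powr_mono) (auto simp: lp_enorm_heis_sphere_const w_def)
    then show "ennreal_powr (lp_enorm q heis_sphere_measure (\<lambda>\<theta>. ennreal (norm (hlp_op f (heis_dilate r \<theta>))))) P \<le>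
      ennreal (?c powr P) * ennreal_powr (?K r) P"
      using P by (simp add: ennreal_powr_mult)
  qed (use P in auto)
  also have "\<dots> \<le> ennreal_powr (ennreal (?c powr P) * (ennreal (C powr P) * (\<integral>\<^sup>+ r. ennreal_powr (F r) P \<partial>?\<nu>))) (1 / P)"
  proof (intro ennreal_powr_mono)
    interpret sigma_finite_measure ?\<nu> by (rule sigma_finite_heis_radial_measure)
    have "(\<integral>\<^sup>+ r. ennreal (?c powr P) * ennreal_powr (?K r) P \<partial>?\<nu>) = ennreal (?c powr P) * (\<integral>\<^sup>+ r. ennreal_powr (?K r) P \<partial>?\<nu>)"
      by (rule nn_integral_cmult) measurable
    also have "\<dots> \<le> ennreal (?c powr P) * (ennreal (C powr P) * (\<integral>\<^sup>+ r. ennreal_powr (F r) P \<partial>?\<nu>))"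
      unfolding C_def a_def using P by (intro mult_left_mono kernel_schur) auto
    finally show "(\<integral>\<^sup>+ r. ennreal (?c powr P) * ennreal_powr (?K r) P \<partial>?\<nu>) \<le>
      ennreal (?c powr P) * (ennreal (C powr P) * (\<integral>\<^sup>+ r. ennreal_powr (F r) P \<partial>?\<nu>))" .
  qed (use P in auto)
  also have "\<dots> = ennreal (?c * C) * N"
    using P C heis_omega_pos[where 'n='n, folded w_def] by (simp add: N_def ennreal_powr_mult powr_powr ennreal_mult mult.assoc)
  finally show ?thesis .
qed

lemma integrable_hlp_integrand:
  assumes q: "1 \<le> q" and fin: "mixed_enorm (ennreal P) q f < top" and x: "x \<noteq> 0"
  shows "integrable lborel (hlp_integrand f x)"
proof -
  note [measurable] = f
  have "N < top"
    using order.strict_trans1[OF sphere_integral_enorm_le[OF q] fin] heis_omega_pos[where 'n='n, folded w_def]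
    by (auto simp: ennreal_mult_less_top)
  then have "(\<integral>\<^sup>+ r. ennreal_powr (F r) P \<partial>heis_radial_measure TYPE('n)) < top"
    by (simp add: N_def)
  moreover have "heis_norm x > 0"
    using x heis_norm_nonneg[of x] heis_norm_eq_0_iff[of x] by (simp add: less_le del: heis_norm_nonneg)
  ultimately have "(\<integral>\<^sup>+ s. F s * ennreal (1 / max (heis_norm x ^ heis_hdim TYPE('n)) (s ^ heis_hdim TYPE('n)))
      \<partial>heis_radial_measure TYPE('n)) < top"
    using P by (intro kernel_integral_finite F_measurable)
  then have "(\<integral>\<^sup>+ y. ennreal (norm (hlp_integrand f x y)) \<partial>lborel) < top"
    unfolding nn_integral_norm_hlp_integrand[OF f] F_def .
  then show ?thesis by (intro integrableI_bounded) auto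
qed

lemma mixed_enorm_hlp_op_le:
  assumes q: "1 \<le> q1" "1 \<le> q2"
  shows "mixed_enorm (ennreal P) q2 (hlp_op f) \<le>
    ennreal (w powr (enn2real (1 / q2) - enn2real (1 / q1)) * (w * C)) * mixed_enorm (ennreal P) q1 f"
proof -
  let ?e1 = "enn2real (1 / q1)" and ?e2 = "enn2real (1 / q2)"
  have C: "C > 0" unfolding C_def a_def using kernel_const_pos[OF P, where 'n='n] by simp
  \<comment> \<open>Splits off the factor \<open>w powr (?e1 - 1)\<close> that accompanies
    \<open>N\<close> in \<open>sphere_integral_enorm_le\<close>; what remains is exactly G.\<close>
  have eq: "w powr ?e2 * C = w powr (?e2 - ?e1) * (w * C) * w powr (?e1 - 1)"
    using heis_omega_pos[where 'n='n, folded w_def] by (simp add: powr_diff)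
  have "mixed_enorm (ennreal P) q2 (hlp_op f) \<le> ennreal (w powr ?e2 * C) * N"
    using q(2) by (rule hlp_op_enorm_le)
  also have "\<dots> = ennreal (w powr (?e2 - ?e1) * (w * C)) * (ennreal (w powr (?e1 - 1)) * N)"
    unfolding eq using heis_omega_pos[where 'n='n, folded w_def] C by (simp add: ennreal_mult mult.assoc)
  also have "\<dots> \<le> ennreal (w powr (?e2 - ?e1) * (w * C)) * mixed_enorm (ennreal P) q1 f"
    using q(1) by (intro mult_left_mono sphere_integral_enorm_le) auto
  finally show ?thesis .
qed

end

text \<open>The unreduced \<open>1 ^ heis_hdim TYPE('n)\<close> keeps the integral in the syntactic
  form of the kernel integrals at \<open>r = 1\<close>.\<close>

lemma hlp_const_eq:
  "hlp_const TYPE('n::finite) p q1 q2 =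
    ennreal (heis_omega TYPE('n) powr (enn2real (1 / q2) - enn2real (1 / q1)) * heis_omega TYPE('n)) *
    (\<integral>\<^sup>+ r. ennreal (r powr (- (real (heis_hdim TYPE('n)) * enn2real (1 / p))) / max (1 ^ heis_hdim TYPE('n)) (r ^ heis_hdim TYPE('n)))
      \<partial>heis_radial_measure TYPE('n))"
  unfolding hlp_const_def using heis_omega_pos[where 'n='n]
  by (subst nn_integral_heis_radial) (auto simp: ennreal_mult mult.assoc)

lemma hlp_const_finite:
  fixes P :: real
  defines "a \<equiv> real (heis_hdim TYPE('n::finite)) / P" and "w \<equiv> heis_omega TYPE('n)"
  assumes P: "1 < P"
  shows "hlp_const TYPE('n) (ennreal P) q1 q2 =
    ennreal (w powr (enn2real (1 / q2) - enn2real (1 / q1)) * (w * (1 / (real (heis_hdim TYPE('n)) - a) + 1 / a)))"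
proof -
  have a: "0 < a" "a < real (heis_hdim TYPE('n))"
    using kernel_exponent[OF P, where 'n='n] by (auto simp: a_def)
  have e: "real (heis_hdim TYPE('n)) * enn2real (1 / ennreal P) = a"
    using P by (simp add: enn2real_inverse_ennreal a_def)
  show ?thesis
    unfolding hlp_const_eq e using a heis_omega_pos[where 'n='n]
    by (subst nn_integral_kernel_powr) (auto simp: w_def ennreal_mult mult.assoc add_pos_pos less_imp_le)
qed

lemma hlp_bounded_finite:
  assumes P: "1 < P" and q: "1 \<le> q1" "1 \<le> q2"
  shows "hlp_bounded TYPE('n::finite) (ennreal P) q1 q2"
  unfolding hlp_bounded_def
proof (intro conjI ballI allI impI exI)
  fix f :: "'n heis \<Rightarrow> complex" assume "f \<in> mixed_space (ennreal P) q1"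
  then have f: "f \<in> borel_measurable borel" "mixed_enorm (ennreal P) q1 f < top"
    by (auto simp: mixed_space_def)
  show "integrable lborel (hlp_integrand f x)" if "x \<noteq> 0" for x
    using f P q(1) that by (intro integrable_hlp_integrand)
  show le: "mixed_enorm (ennreal P) q2 (hlp_op f) \<le> ennreal (heis_omega TYPE('n) powr (enn2real (1 / q2) - enn2real (1 / q1)) *
      (heis_omega TYPE('n) * (1 / (real (heis_hdim TYPE('n)) - real (heis_hdim TYPE('n)) / P) + 1 / (real (heis_hdim TYPE('n)) / P)))) * mixed_enorm (ennreal P) q1 f"
    using f P q by (intro mixed_enorm_hlp_op_le)
  then show "hlp_op f \<in> mixed_space (ennreal P) q2"
    using f by (auto simp: mixed_space_def hlp_op_measurable ennreal_mult_less_top intro: order.strict_trans1)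
qed

lemma mixed_opnorm_hlp_op_le:
  assumes P: "1 < P" and q: "1 \<le> q1" "1 \<le> q2"
  shows "mixed_opnorm (ennreal P) q1 q2 (hlp_op :: ('n::finite heis \<Rightarrow> complex) \<Rightarrow> _) \<le> hlp_const TYPE('n) (ennreal P) q1 q2"
  unfolding mixed_opnorm_def
proof (rule SUP_least, clarify)
  fix f :: "'n heis \<Rightarrow> complex" assume "f \<in> mixed_space (ennreal P) q1" and nz: "mixed_enorm (ennreal P) q1 f \<noteq> 0"
  then have f: "f \<in> borel_measurable borel" "mixed_enorm (ennreal P) q1 f < top"
    by (auto simp: mixed_space_def)
  have "mixed_enorm (ennreal P) q2 (hlp_op f) \<le> hlp_const TYPE('n) (ennreal P) q1 q2 * mixed_enorm (ennreal P) q1 f"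
    unfolding hlp_const_finite[OF P] using f P q by (intro mixed_enorm_hlp_op_le)
  then have "mixed_enorm (ennreal P) q2 (hlp_op f) / mixed_enorm (ennreal P) q1 f \<le>
    hlp_const TYPE('n) (ennreal P) q1 q2 * mixed_enorm (ennreal P) q1 f / mixed_enorm (ennreal P) q1 f"
    by (rule divide_right_mono_ennreal)
  also have "\<dots> = hlp_const TYPE('n) (ennreal P) q1 q2"
    using f(2) nz by (simp add: ennreal_mult_divide_eq)
  finally show "mixed_enorm (ennreal P) q2 (hlp_op f) / mixed_enorm (ennreal P) q1 f \<le> hlp_const TYPE('n) (ennreal P) q1 q2" .
qed

section \<open>Near-extremal functions\<close>

text \<open>The power \<open>s powr (- a)\<close> damped by \<open>exp (- e * \<bar>ln s\<bar>)\<close>: by the triangle inequality for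
  \<open>\<bar>ln s\<bar>\<close> it dominates its own dilates, and no truncation of the domain is needed.\<close>

definition tent :: "real \<Rightarrow> real \<Rightarrow> real \<Rightarrow> real" where
  "tent a e s = s powr (- a) * min (s powr e) (s powr (- e))"

lemma tent_measurable [measurable]: "tent a e \<in> borel_measurable borel"
  unfolding tent_def[abs_def] by measurable

lemma tent_nonneg [simp]: "0 \<le> tent a e s"
  by (simp add: tent_def)

lemma tent_pos: "0 < s \<Longrightarrow> 0 < tent a e s"
  by (simp add: tent_def)

lemma tent_1 [simp]: "tent a e 1 = 1"
  by (simp add: tent_def)

lemma tent_le:
  assumes "0 < e" "0 < s"
  shows "tent a e s \<le> s powr (e - a)" "tent a e s \<le> s powr (- a - e)" "tent a e s \<le> s powr (- a)"
proof -
  have *: "s powr (- a) * min (s powr e) (s powr (- e)) \<le> s powr (- a) * y" if "min (s powr e) (s powr (- e)) \<le> y" for y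
    using that by (intro mult_left_mono) auto
  have "min (s powr e) (s powr (- e)) \<le> 1"
  proof (cases "s \<le> 1")
    case True
    then have "s powr e \<le> 1 powr e" using assms by (intro powr_mono2) auto
    then show ?thesis by simp
  next
    case False
    then have "s powr (- e) \<le> 1 powr (- e)" using assms by (intro powr_mono2') auto
    then show ?thesis by simp
  qed
  from *[OF this] show "tent a e s \<le> s powr (- a)" by (simp add: tent_def)
  show "tent a e s \<le> s powr (e - a)" "tent a e s \<le> s powr (- a - e)"
    using *[of "s powr e"] *[of "s powr (- e)"] assms by (auto simp: tent_def powr_add[symmetric] algebra_simps)
qed

lemma tent_eq:
  assumes "0 < e" "0 < s"
  shows "tent a e s = (if s \<le> 1 then s powr (e - a) else s powr (- a - e))"
proof (cases "s \<le> 1")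
  case True
  then have "s powr e \<le> s powr (- e)" using assms by (intro powr_mono') auto
  then show ?thesis using True by (simp add: tent_def powr_add[symmetric] min_def)
next
  case False
  then have "s powr (- e) \<le> s powr e" using assms by (intro powr_mono) auto
  then have "min (s powr e) (s powr (- e)) = s powr (- e)" by simp
  then show ?thesis using False by (simp add: tent_def powr_add[symmetric] algebra_simps)
qed

lemma tent_dilate_ge:
  assumes "0 < e" "0 < r" "0 < s"
  shows "tent a e r * tent a e (s / r) \<le> tent a e s"
proof -
  have *: "min (r powr e) (r powr (- e)) * min ((s / r) powr e) ((s / r) powr (- e)) \<le> s powr x"
    if "x = e \<or> x = - e" for x
  proof -
    have "min (r powr e) (r powr (- e)) * min ((s / r) powr e) ((s / r) powr (- e)) \<le> r powr x * (s / r) powr x"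
      using that by (intro mult_mono) (auto simp: min_le_iff_disj)
    also have "\<dots> = s powr x" using assms by (simp add: powr_divide)
    finally show ?thesis .
  qed
  have "tent a e r * tent a e (s / r) =
      (r powr (- a) * (s / r) powr (- a)) * (min (r powr e) (r powr (- e)) * min ((s / r) powr e) ((s / r) powr (- e)))"
    by (simp add: tent_def)
  also have "r powr (- a) * (s / r) powr (- a) = s powr (- a)"
    using assms by (simp add: powr_divide)
  also have "s powr (- a) * (min (r powr e) (r powr (- e)) * min ((s / r) powr e) ((s / r) powr (- e))) \<le> tent a e s"
    unfolding tent_def using * by (intro mult_left_mono) auto
  finally show ?thesis .
qed

context
  fixes a e r :: real and Q :: nat and \<nu> :: "real measure"
  defines "Q \<equiv> heis_hdim TYPE('n::finite)" and "\<nu> \<equiv> heis_radial_measure TYPE('n)"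
  assumes a: "0 \<le> a" "a \<le> real Q" and e: "0 < e" and r: "0 < r"
begin

text \<open>\<open>tent_dilate_ge\<close> moves the break of the tent from 1 to \<open>r\<close>,
  where the kernel breaks too, so the minorant is an exact power on each side of \<open>r\<close>.
  The shift by \<open>e\<close> keeps both denominators positive even for \<open>a = 0\<close> and
  \<open>a = real Q\<close>, so the endpoint exponents are included.\<close>

lemma tent_kernel_ge:
  "ennreal (tent a e r * (1 / (real Q - a + e) + 1 / (a + e))) \<le>
    (\<integral>\<^sup>+ s. ennreal (tent a e s / max (r ^ Q) (s ^ Q)) \<partial>\<nu>)"
proof -
  \<comment> \<open>\<open>c\<close> and \<open>d\<close> gather the powers of \<open>r\<close> that
    come from \<open>tent a e (s / r)\<close> below and above \<open>r\<close>; in \<open>c\<close>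
    the kernel adds \<open>r powr (- real Q)\<close>.\<close>
  define c where "c = tent a e r * r powr (a - e - real Q)"
  define d where "d = tent a e r * r powr (a + e)"
  have pos: "0 < real Q - a + e" "0 < a + e" using a e by auto
  have "tent a e r * (1 / (real Q - a + e) + 1 / (a + e)) =
      c * r powr (real Q - a + e) / (real Q - a + e) + d * r powr (- (a + e)) / (a + e)"
  proof -
    have "r powr (a - e - real Q) * r powr (real Q - a + e) = 1" "r powr (a + e) * r powr (- (a + e)) = 1"
      using r by (simp_all flip: powr_add)
    then show ?thesis unfolding c_def d_def mult.assoc by (simp add: distrib_left)
  qed
  also have "ennreal \<dots> =
      (\<integral>\<^sup>+ s. ennreal (if s \<le> r then c * s powr (real Q - a + e - real Q) else d * s powr (- (a + e) - real Q)) \<partial>\<nu>)"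
    unfolding \<nu>_def Q_def using pos r
    by (intro nn_integral_heis_radial_powr_pieces[symmetric]) (auto simp: c_def d_def Q_def)
  also have "\<dots> \<le> (\<integral>\<^sup>+ s. ennreal (tent a e s / max (r ^ Q) (s ^ Q)) \<partial>\<nu>)"
    unfolding \<nu>_def
  proof (intro nn_integral_mono_AE AE_heis_radial_measure ennreal_leI)
    fix s :: real assume s: "0 < s"
    have "tent a e r * tent a e (s / r) / max (r ^ Q) (s ^ Q) \<le> tent a e s / max (r ^ Q) (s ^ Q)"
      using tent_dilate_ge[OF e r s] r by (intro divide_right_mono) (auto simp: le_max_iff_disj)
    then have "tent a e r * tent a e (s / r) / (if s \<le> r then r powr real Q else s powr real Q) \<le>
      tent a e s / max (r ^ Q) (s ^ Q)"
      unfolding max_power_eq_powr[OF r s] .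
    also have "tent a e (s / r) = (if s \<le> r then (s / r) powr (e - a) else (s / r) powr (- a - e))"
      using e r s by (simp add: tent_eq)
    finally show "(if s \<le> r then c * s powr (real Q - a + e - real Q) else d * s powr (- (a + e) - real Q)) \<le>
      tent a e s / max (r ^ Q) (s ^ Q)"
      using r s by (auto simp: c_def d_def powr_divide powr_diff powr_add powr_minus field_simps split: if_splits)
  qed
  finally show ?thesis .
qed

text \<open>Supplies the integrability without which \<open>hlp_op\<close> of the test function
  would be the default value 0. Each of the two powers bounds the tent on the whole half-line, so
  they may be used on the two sides of \<open>r\<close> although the tent breaks at 1.\<close>

lemma tent_kernel_finite: "(\<integral>\<^sup>+ s. ennreal (tent a e s / max (r ^ Q) (s ^ Q)) \<partial>\<nu>) < top"
proof -
  have pos: "0 < real Q - a + e" "0 < a + e" using a e by auto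
  have "(\<integral>\<^sup>+ s. ennreal (tent a e s / max (r ^ Q) (s ^ Q)) \<partial>\<nu>) \<le>
    (\<integral>\<^sup>+ s. ennreal (if s \<le> r then r powr (- real Q) * s powr (real Q - a + e - real Q) else 1 * s powr (- (a + e) - real Q)) \<partial>\<nu>)"
    unfolding \<nu>_def
  proof (intro nn_integral_mono_AE AE_heis_radial_measure ennreal_leI)
    fix s :: real assume s: "0 < s"
    have le: "tent a e s / max (r ^ Q) (s ^ Q) \<le> s powr x / max (r ^ Q) (s ^ Q)" if "x = e - a \<or> x = - a - e" for x
      using tent_le[OF e s] that r by (intro divide_right_mono) (auto simp: le_max_iff_disj)
    show "tent a e s / max (r ^ Q) (s ^ Q) \<le>
      (if s \<le> r then r powr (- real Q) * s powr (real Q - a + e - real Q) else 1 * s powr (- (a + e) - real Q))"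
      using le[of "e - a"] le[of "- a - e"] unfolding kernel_powr_eq[OF r s] by (auto simp: algebra_simps)
  qed
  also have "\<dots> < top"
    unfolding \<nu>_def Q_def using pos r by (subst nn_integral_heis_radial_powr_pieces) (auto simp: Q_def)
  finally show ?thesis .
qed

end

text \<open>If the measure were null, every integral would vanish, but
  \<open>nn_integral_kernel_powr\<close> with \<open>r = 1\<close> and exponent 1, which is less
  than Q, has a positive value.\<close>

lemma not_AE_False_heis_radial_measure: "\<not> (AE r in heis_radial_measure TYPE('n::finite). False)"
proof
  assume "AE r in heis_radial_measure TYPE('n). False"
  then have "(\<integral>\<^sup>+ r. ennreal (r powr (- 1) / max (1 ^ heis_hdim TYPE('n)) (r ^ heis_hdim TYPE('n))) \<partial>heis_radial_measure TYPE('n)) =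
    (\<integral>\<^sup>+ r. 0 \<partial>heis_radial_measure TYPE('n))"
    by (intro nn_integral_cong_AE) (auto elim: eventually_mono)
  moreover have "(\<integral>\<^sup>+ r. ennreal (r powr (- 1) / max (1 ^ heis_hdim TYPE('n)) (r ^ heis_hdim TYPE('n))) \<partial>heis_radial_measure TYPE('n)) =
    ennreal (1 powr (- 1) * (1 / (real (heis_hdim TYPE('n)) - 1) + 1 / 1))"
    by (rule nn_integral_kernel_powr) (auto simp: heis_hdim_def)
  ultimately show False by (simp add: heis_hdim_def ennreal_eq_0_iff)
qed

lemma lp_enorm_eq_0_AE:
  assumes [measurable]: "g \<in> borel_measurable M" and "lp_enorm p M g = 0"
  shows "AE x in M. g x = 0"
proof (cases "p = \<infinity>")
  case True
  then show ?thesis using esssup_AE[where M=M and f=g] assms(2) by (simp add: lp_enorm_def)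
next
  case False
  then show ?thesis using assms(2) by (simp add: lp_enorm_def nn_integral_0_iff_AE)
qed

text \<open>Makes the tents admissible in the supremum. For finite \<open>p\<close> the damping
  turns the critical power \<open>- Q\<close> of the integrand into \<open>e * P - Q\<close> below 1
  and \<open>- e * P - Q\<close> above 1; for infinite \<open>p\<close> the exponent
  \<open>a\<close> is 0 and the tent is at most 1.\<close>

lemma
  fixes p :: ennreal
  assumes p: "1 \<le> p" and e: "0 < e"
  defines "a \<equiv> real (heis_hdim TYPE('n::finite)) * enn2real (1 / p)"
  shows tent_enorm_nonzero: "lp_enorm p (heis_radial_measure TYPE('n)) (\<lambda>r. ennreal (tent a e \<bar>r\<bar>)) \<noteq> 0" (is ?A)
    and tent_enorm_finite: "lp_enorm p (heis_radial_measure TYPE('n)) (\<lambda>r. ennreal (tent a e \<bar>r\<bar>)) < top" (is ?B)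
    and tent_exponent: "0 \<le> a" "a \<le> real (heis_hdim TYPE('n))" (is ?C)
proof -
  let ?\<nu> = "heis_radial_measure TYPE('n)" and ?Q = "real (heis_hdim TYPE('n))"
  show ?A
  proof
    assume "lp_enorm p ?\<nu> (\<lambda>r. ennreal (tent a e \<bar>r\<bar>)) = 0"
    then have "AE r in ?\<nu>. ennreal (tent a e \<bar>r\<bar>) = 0"
      by (intro lp_enorm_eq_0_AE) measurable
    moreover have "AE r in ?\<nu>. ennreal (tent a e \<bar>r\<bar>) \<noteq> 0"
      using tent_pos by (intro AE_heis_radial_measure) (auto simp: ennreal_eq_0_iff not_le)
    ultimately have "AE r in ?\<nu>. False" by eventually_elim simp
    then show False using not_AE_False_heis_radial_measure by blast
  qed
  show "0 \<le> a" by (simp add: a_def)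
  have "?B \<and> ?C"
  proof (cases "p = \<infinity>")
    case True
    have "tent 0 e s \<le> 1" if "0 < s" for s
      using tent_le(3)[OF e that, of 0] that by simp
    then have "lp_enorm p ?\<nu> (\<lambda>r. ennreal (tent a e \<bar>r\<bar>)) \<le> 1"
      using True by (auto simp: lp_enorm_def a_def intro!: esssup_I AE_heis_radial_measure)
    then show ?thesis using True by (auto simp: a_def intro: order.strict_trans1)
  next
    case False
    define P where "P = enn2real p"
    have pP: "p = ennreal P" using False by (simp add: P_def less_top)
    have P: "1 \<le> P" using p unfolding pP by simp
    have a: "a = ?Q / P" using P by (simp add: a_def pP enn2real_inverse_ennreal)
    have exps: "(e - a) * P = e * P - ?Q" "(- a - e) * P = - (e * P) - ?Q"
      using P by (simp_all add: a algebra_simps)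
    have "(\<integral>\<^sup>+ r. ennreal_powr (ennreal (tent a e \<bar>r\<bar>)) P \<partial>?\<nu>) =
      (\<integral>\<^sup>+ s. ennreal (if s \<le> 1 then 1 * s powr (e * P - ?Q) else 1 * s powr (- (e * P) - ?Q)) \<partial>?\<nu>)"
      using P e by (intro nn_integral_cong_AE AE_heis_radial_measure)
        (auto simp: tent_eq powr_powr exps)
    also have "\<dots> < top"
      using P e by (subst nn_integral_heis_radial_powr_pieces) auto
    finally have ?B using P by (simp add: pP lp_enorm_ennreal)
    moreover have ?C using P by (simp add: a field_simps mult_left_le)
    ultimately show ?thesis by simp
  qed
  then show ?B ?C by auto
qed

lemma ex_heis_norm: "0 \<le> r \<Longrightarrow> \<exists>x :: 'n::finite heis. heis_norm x = r"
  by (rule exI[of _ "(0, 0, r\<^sup>2)"]) (simp add: heis_norm_def real_root_power_cancel flip: power_mult)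

section \<open>Lower bound for the operator norm\<close>

text \<open>For nonnegative data the integrand equals its own norm, so no cancellation occurs and
  \<open>norm_hlp_op_le\<close> becomes an equality.\<close>

lemma norm_hlp_op_of_real:
  fixes g :: "'n::finite heis \<Rightarrow> real"
  assumes "integrable lborel (hlp_integrand (\<lambda>y. complex_of_real (g y)) x)" and "\<And>y. 0 \<le> g y"
  shows "ennreal (norm (hlp_op (\<lambda>y. complex_of_real (g y)) x)) =
    (\<integral>\<^sup>+ y. ennreal (norm (hlp_integrand (\<lambda>y. complex_of_real (g y)) x y)) \<partial>lborel)"
proof -
  define h where "h y = norm (hlp_integrand (\<lambda>y. complex_of_real (g y)) x y)" for y
  have eq: "hlp_integrand (\<lambda>y. complex_of_real (g y)) x = (\<lambda>y. complex_of_real (h y))"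
  proof
    fix y show "hlp_integrand (\<lambda>y. complex_of_real (g y)) x y = complex_of_real (h y)"
      using assms(2)[of y] unfolding h_def norm_hlp_integrand by (simp add: hlp_integrand_def)
  qed
  have [simp]: "0 \<le> h y" for y by (simp add: h_def)
  show ?thesis
    using assms(1) unfolding hlp_op_def eq by (simp add: complex_of_real_integrable_eq nn_integral_eq_integral)
qed

text \<open>The radial norm \<open>N\<close> of the tent occurs in the norms of both
  \<open>f\<close> and H f and cancels in the quotient, which is legitimate because it is neither 0
  nor infinite.\<close>

lemma mixed_opnorm_hlp_op_ge:
  fixes p q1 q2 :: ennreal
  defines "a \<equiv> real (heis_hdim TYPE('n::finite)) * enn2real (1 / p)" and "w \<equiv> heis_omega TYPE('n)"
  assumes p: "1 \<le> p" and q: "1 \<le> q1" "1 \<le> q2" and e: "0 < e"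
  shows "ennreal (w powr (enn2real (1 / q2) - enn2real (1 / q1)) * w * (1 / (real (heis_hdim TYPE('n)) - a + e) + 1 / (a + e)))
    \<le> mixed_opnorm p q1 q2 (hlp_op :: ('n heis \<Rightarrow> complex) \<Rightarrow> _)"
proof -
  let ?\<nu> = "heis_radial_measure TYPE('n)" and ?Q = "heis_hdim TYPE('n)"
  let ?e1 = "enn2real (1 / q1)" and ?e2 = "enn2real (1 / q2)"
  define c where "c = 1 / (real ?Q - a + e) + 1 / (a + e)"
  define f :: "'n heis \<Rightarrow> complex" where "f = (\<lambda>x. complex_of_real (tent a e (heis_norm x)))"
  define N where "N = lp_enorm p ?\<nu> (\<lambda>r. ennreal (tent a e \<bar>r\<bar>))"
  have a: "0 \<le> a" "a \<le> real ?Q"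
    using tent_exponent[OF p e, where 'n='n] by (auto simp: a_def)
  have N: "N \<noteq> 0" "N < top"
    using tent_enorm_nonzero[OF p e, where 'n='n] tent_enorm_finite[OF p e, where 'n='n] by (auto simp: a_def N_def)
  have w: "0 < w" unfolding w_def by (rule heis_omega_pos)
  have c: "0 < c" unfolding c_def using a e by (intro add_pos_pos) auto
  have [measurable]: "f \<in> borel_measurable borel" unfolding f_def by measurable
  note [measurable] = hlp_op_measurable[OF this]
  have f_norm: "mixed_enorm p q1 f = ennreal (w powr ?e1) * N"
    unfolding N_def w_def using p q by (intro mixed_enorm_radial) (auto simp: f_def)

  have I: "(\<integral>\<^sup>+ y. ennreal (norm (hlp_integrand f x y)) \<partial>lborel) =
      ennreal w * (\<integral>\<^sup>+ s. ennreal (tent a e s / max (heis_norm x ^ ?Q) (s ^ ?Q)) \<partial>?\<nu>)" for x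
    unfolding w_def by (subst nn_integral_heis_radial[symmetric]) (simp_all add: norm_hlp_integrand f_def)
  have norm_op: "ennreal (w * c * tent a e (heis_norm x)) \<le> ennreal (norm (hlp_op f x))" if "0 < heis_norm x" for x
  proof -
    have "(\<integral>\<^sup>+ y. ennreal (norm (hlp_integrand f x y)) \<partial>lborel) < top"
      unfolding I using a e that by (auto intro!: ennreal_mult_less_top[THEN iffD2] tent_kernel_finite)
    then have "integrable lborel (hlp_integrand f x)"
      by (intro integrableI_bounded) auto
    then have "ennreal (norm (hlp_op f x)) = ennreal w * (\<integral>\<^sup>+ s. ennreal (tent a e s / max (heis_norm x ^ ?Q) (s ^ ?Q)) \<partial>?\<nu>)"
      unfolding I[symmetric] f_def by (intro norm_hlp_op_of_real) auto
    also have "\<dots> \<ge> ennreal w * ennreal (tent a e (heis_norm x) * c)"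
      unfolding c_def using a e that by (intro mult_left_mono tent_kernel_ge) auto
    finally show ?thesis using w c by (simp add: ac_simps flip: ennreal_mult)
  qed

  \<comment> \<open>A radial profile of |H f|, obtained by replacing \<open>heis_norm x\<close> with
    a free variable. It is measurable on the line, as \<open>mixed_enorm_radial\<close>
    requires.\<close>
  define \<psi> where "\<psi> r = norm (\<integral>y. f y / complex_of_real (max (r ^ ?Q) (heis_norm y ^ ?Q)) \<partial>lborel)" for r
  have "(\<lambda>(r, y). f y / complex_of_real (max (r ^ ?Q) (heis_norm y ^ ?Q))) \<in> borel_measurable (borel \<Otimes>\<^sub>M lborel)"
    by measurable
  from lborel.borel_measurable_lebesgue_integral[OF this]
  have [measurable]: "\<psi> \<in> borel_measurable borel" unfolding \<psi>_def[abs_def] by measurable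
  have \<psi>: "norm (hlp_op f x) = \<psi> (heis_norm x)" for x
    by (simp add: hlp_op_def hlp_integrand_def \<psi>_def)
  have "ennreal (w * c) * N = lp_enorm p ?\<nu> (\<lambda>r. ennreal (w * c) * ennreal (tent a e \<bar>r\<bar>))"
    unfolding N_def using w c p by (intro lp_enorm_cmult[symmetric]) auto
  also have "\<dots> \<le> lp_enorm p ?\<nu> (\<lambda>r. ennreal (\<psi> \<bar>r\<bar>))"
  proof (intro lp_enorm_mono AE_heis_radial_measure)
    fix r :: real assume r: "0 < r"
    obtain x :: "'n heis" where x: "heis_norm x = r" using ex_heis_norm r by (metis less_imp_le)
    show "ennreal (w * c) * ennreal (tent a e \<bar>r\<bar>) \<le> ennreal (\<psi> \<bar>r\<bar>)"
      using norm_op[of x] \<psi>[of x] r w c by (simp add: x flip: ennreal_mult)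
  qed measurable
  finally have "ennreal (w powr ?e2) * (ennreal (w * c) * N) \<le> ennreal (w powr ?e2) * lp_enorm p ?\<nu> (\<lambda>r. ennreal (\<psi> \<bar>r\<bar>))"
    by (rule mult_left_mono) simp
  also have "\<dots> = mixed_enorm p q2 (hlp_op f)"
    unfolding w_def using p q \<psi> by (intro mixed_enorm_radial[symmetric]) auto
  finally have ge: "ennreal (w powr ?e2) * (ennreal (w * c) * N) \<le> mixed_enorm p q2 (hlp_op f)" .
  have "ennreal (w powr (?e2 - ?e1) * w * c) * mixed_enorm p q1 f \<le> mixed_enorm p q2 (hlp_op f)"
  proof -
    have "w powr ?e2 * (w * c) = w powr (?e2 - ?e1) * w * c * w powr ?e1"
      using w by (simp add: powr_diff)
    then have "ennreal (w powr ?e2) * ennreal (w * c) = ennreal (w powr (?e2 - ?e1) * w * c) * ennreal (w powr ?e1)"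
      using w c by (metis ennreal_mult less_imp_le mult_pos_pos powr_gt_zero less_irrefl)
    then have "ennreal (w powr ?e2) * (ennreal (w * c) * N) = ennreal (w powr (?e2 - ?e1) * w * c) * (ennreal (w powr ?e1) * N)"
      by (simp only: mult.assoc[symmetric])
    then show ?thesis using ge by (simp add: f_norm)
  qed
  moreover have nz: "mixed_enorm p q1 f \<noteq> 0" "mixed_enorm p q1 f < top"
    using N w by (auto simp: f_norm ennreal_mult_less_top ennreal_eq_0_iff)
  ultimately have "ennreal (w powr (?e2 - ?e1) * w * c) * mixed_enorm p q1 f / mixed_enorm p q1 f \<le>
      mixed_enorm p q2 (hlp_op f) / mixed_enorm p q1 f"
    by (intro divide_right_mono_ennreal)
  then have "ennreal (w powr (?e2 - ?e1) * w * c) \<le> mixed_enorm p q2 (hlp_op f) / mixed_enorm p q1 f"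
    using nz by (simp add: ennreal_mult_divide_eq)
  also have "\<dots> \<le> mixed_opnorm p q1 q2 (hlp_op :: ('n heis \<Rightarrow> complex) \<Rightarrow> _)"
    unfolding mixed_opnorm_def using nz by (intro SUP_upper2[where i=f]) (auto simp: mixed_space_def)
  finally show ?thesis by (simp add: c_def)
qed

text \<open>The tent lies below \<open>s powr (- a)\<close>, so its kernel integral at
  \<open>r = 1\<close> bounds the integral in G. It serves to show that G is infinite for the
  endpoint exponents, which \<open>nn_integral_kernel_powr\<close> does not cover.\<close>

lemma hlp_const_ge:
  fixes p q1 q2 :: ennreal
  defines "a \<equiv> real (heis_hdim TYPE('n::finite)) * enn2real (1 / p)" and "w \<equiv> heis_omega TYPE('n)"
  assumes p: "1 \<le> p" and e: "0 < e"
  shows "ennreal (w powr (enn2real (1 / q2) - enn2real (1 / q1)) * w * (1 / (real (heis_hdim TYPE('n)) - a + e) + 1 / (a + e)))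
    \<le> hlp_const TYPE('n) p q1 q2"
proof -
  let ?\<nu> = "heis_radial_measure TYPE('n)" and ?Q = "heis_hdim TYPE('n)"
  let ?k = "w powr (enn2real (1 / q2) - enn2real (1 / q1)) * w"
  define c where "c = 1 / (real ?Q - a + e) + 1 / (a + e)"
  have a: "0 \<le> a" "a \<le> real ?Q"
    using tent_exponent[OF p e, where 'n='n] by (auto simp: a_def)
  have k: "0 \<le> ?k" unfolding w_def using heis_omega_pos[where 'n='n] by simp
  have c: "0 < c" unfolding c_def using a e by (intro add_pos_pos) auto
  have "ennreal c \<le> (\<integral>\<^sup>+ s. ennreal (tent a e s / max (1 ^ ?Q) (s ^ ?Q)) \<partial>?\<nu>)"
    using tent_kernel_ge[of a e 1, where 'n='n] a e by (simp add: c_def)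
  also have "\<dots> \<le> (\<integral>\<^sup>+ s. ennreal (s powr (- a) / max (1 ^ ?Q) (s ^ ?Q)) \<partial>?\<nu>)"
    by (intro nn_integral_mono_AE AE_heis_radial_measure ennreal_leI divide_right_mono tent_le e) (auto simp: le_max_iff_disj)
  finally have "ennreal ?k * ennreal c \<le> hlp_const TYPE('n) p q1 q2"
    unfolding hlp_const_eq w_def a_def by (rule mult_left_mono) simp
  then show ?thesis using k c by (simp add: c_def flip: ennreal_mult)
qed

lemma mixed_opnorm_hlp_op_ge_const:
  assumes P: "1 < P" and q: "1 \<le> q1" "1 \<le> q2"
  shows "hlp_const TYPE('n::finite) (ennreal P) q1 q2 \<le> mixed_opnorm (ennreal P) q1 q2 (hlp_op :: ('n heis \<Rightarrow> complex) \<Rightarrow> _)"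
proof -
  define a where "a = real (heis_hdim TYPE('n)) / P"
  define k where "k = heis_omega TYPE('n) powr (enn2real (1 / q2) - enn2real (1 / q1)) * heis_omega TYPE('n)"
  let ?Q = "real (heis_hdim TYPE('n))"
  have a: "0 < a" "a < ?Q"
    using kernel_exponent[OF P, where 'n='n] by (auto simp: a_def)
  have e: "?Q * enn2real (1 / ennreal P) = a"
    using P by (simp add: enn2real_inverse_ennreal a_def)
  \<comment> \<open>Both denominators stay away from 0 in the limit, since \<open>a\<close> lies
    strictly between 0 and \<open>?Q\<close>.\<close>
  have "((\<lambda>e. ennreal (k * (1 / (?Q - a + e) + 1 / (a + e)))) \<longlongrightarrow> ennreal (k * (1 / (?Q - a + 0) + 1 / (a + 0)))) (at_right 0)"
    using a by (intro tendsto_intros) auto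
  moreover have "\<forall>\<^sub>F e in at_right 0. ennreal (k * (1 / (?Q - a + e) + 1 / (a + e))) \<le>
      mixed_opnorm (ennreal P) q1 q2 (hlp_op :: ('n heis \<Rightarrow> complex) \<Rightarrow> _)"
    using mixed_opnorm_hlp_op_ge[of "ennreal P" q1 q2, where 'n='n] P q
    by (auto simp: eventually_at_right_less e k_def intro: eventually_mono[OF eventually_at_right_less])
  ultimately have "ennreal (k * (1 / (?Q - a + 0) + 1 / (a + 0))) \<le> mixed_opnorm (ennreal P) q1 q2 (hlp_op :: ('n heis \<Rightarrow> complex) \<Rightarrow> _)"
    by (intro tendsto_upperbound) auto
  then show ?thesis
    unfolding hlp_const_finite[OF P] by (simp add: a_def k_def mult.assoc)
qed

section \<open>Endpoint exponents and conclusion\<close>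

lemma ennreal_eq_top_if_ge_inverse:
  fixes x :: ennreal
  assumes "0 < k" and "\<And>e. 0 < e \<Longrightarrow> ennreal (k / e) \<le> x"
  shows "x = top"
proof (rule ccontr)
  assume "x \<noteq> top"
  then obtain y where y: "x = ennreal y" "0 \<le> y" by (cases x) auto
  \<comment> \<open>The choice \<open>e = k / (y + 1)\<close> turns the bound into
    \<open>y + 1 \<le> y\<close>.\<close>
  have "k / (k / (y + 1)) \<le> y"
    using assms(2)[of "k / (y + 1)"] assms(1) y by simp
  then show False using assms(1) y by simp
qed

lemma mixed_opnorm_hlp_op:
  fixes p q1 q2 :: ennreal
  assumes p: "1 \<le> p" and q: "1 \<le> q1" "1 \<le> q2"
  shows "mixed_opnorm p q1 q2 (hlp_op :: ('n::finite heis \<Rightarrow> complex) \<Rightarrow> _) = hlp_const TYPE('n) p q1 q2"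
proof (cases "1 < p \<and> p < \<infinity>")
  case True
  then obtain P where "p = ennreal P" "1 < P" by (cases p) auto
  then show ?thesis
    using q mixed_opnorm_hlp_op_le[of P q1 q2, where 'n='n] mixed_opnorm_hlp_op_ge_const[of P q1 q2, where 'n='n]
    by simp
next
  case False
  define k where "k = heis_omega TYPE('n) powr (enn2real (1 / q2) - enn2real (1 / q1)) * heis_omega TYPE('n)"
  define a where "a = real (heis_hdim TYPE('n)) * enn2real (1 / p)"
  have k: "0 < k" unfolding k_def using heis_omega_pos[where 'n='n] by simp
  have "p = 1 \<or> p = \<infinity>" using False p by (auto simp: less_top)
  then have a: "a = real (heis_hdim TYPE('n)) \<or> a = 0"
    by (auto simp: a_def)
  \<comment> \<open>For \<open>a = Q\<close> the first denominator equals \<open>e\<close>, for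
    \<open>a = 0\<close> the second; the other fraction is positive and is dropped.\<close>
  have le: "ennreal (k / e) \<le> ennreal (k * (1 / (real (heis_hdim TYPE('n)) - a + e) + 1 / (a + e)))" if "0 < e" for e
  proof (rule ennreal_leI)
    have "k * (1 / e) \<le> k * (1 / (real (heis_hdim TYPE('n)) - a + e) + 1 / (a + e))"
      using a that k by (intro mult_left_mono) auto
    then show "k / e \<le> k * (1 / (real (heis_hdim TYPE('n)) - a + e) + 1 / (a + e))" by simp
  qed
  have "mixed_opnorm p q1 q2 (hlp_op :: ('n heis \<Rightarrow> complex) \<Rightarrow> _) = top"
    using mixed_opnorm_hlp_op_ge[OF p q, where 'n='n] le
    by (intro ennreal_eq_top_if_ge_inverse[OF k]) (force simp: a_def k_def intro: order_trans)
  moreover have "hlp_const TYPE('n) p q1 q2 = top"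
    using hlp_const_ge[OF p, of _ q2 q1, where 'n='n] le
    by (intro ennreal_eq_top_if_ge_inverse[OF k]) (force simp: a_def k_def intro: order_trans)
  ultimately show ?thesis by simp
qed

text \<open>Boundedness is asserted for \<open>1 < p < \<infinity>\<close> only: at both endpoints
  the operator norm is infinite, which excludes a finite constant in \<open>hlp_bounded\<close>. The
  inequality and the equality of norms both come from \<open>mixed_opnorm_hlp_op\<close>, which
  holds in \<open>ennreal\<close> for all exponents from 1 to infinity.\<close>

theorem theorem3:
  fixes p p1 p2 :: ennreal
  assumes "CARD('n::finite) \<ge> 2"
    and "1 \<le> p" and "1 \<le> p1" and "1 \<le> p2"
  shows "(1 < p \<and> p < \<infinity> \<longrightarrow> hlp_bounded TYPE('n) p p1 p2) \<and>
    mixed_opnorm p p1 p2 (hlp_op :: ('n heis \<Rightarrow> complex) \<Rightarrow> 'n heis \<Rightarrow> complex)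
      \<le> hlp_const TYPE('n) p p1 p2 \<and>
    (hlp_bounded TYPE('n) p p1 p2 \<longrightarrow>
      mixed_opnorm p p1 p2 (hlp_op :: ('n heis \<Rightarrow> complex) \<Rightarrow> 'n heis \<Rightarrow> complex)
        = hlp_const TYPE('n) p p1 p2)"
proof -
  have "hlp_bounded TYPE('n) p p1 p2" if "1 < p" "p < \<infinity>"
    using that assms(3,4) by (cases p) (auto intro: hlp_bounded_finite)
  then show ?thesis
    using mixed_opnorm_hlp_op[OF assms(2-4), where 'n='n] by simp
qed

end
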